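(* Let $q=2^{2e+1}$ with $e\ge 1$. All Buekenhout-Tits unitals in $\mathrm{PG}(2,q^2)$ are $\mathrm{PGL}$-equivalent; that is, for any two Buekenhout-Tits unitals $U_1,U_2$ in $\mathrm{PG}(2,q^2)$ there is an element of $\mathrm{PGL}(3,q^2)$ mapping $U_1$ onto $U_2$.
   Context: A unital in $\mathrm{PG}(2,q^2)$ is a set of $q^3+1$ points such that every line meets it in $1$ or $q+1$ points. André/Bruck-Bose (ABB) construction: fix a hyperplane $\Sigma$ of $\mathrm{PG}(4,q)$ and a Desarguesian line spread $\mathcal{S}$ of $\Sigma\cong\mathrm{PG}(3,q)$. The plane $\mathrm{PG}(2,q^2)$ is modelled as follows: the points are the points of $\mathrm{PG}(4,q)\setminus\Sigma$ together with the lines of $\mathcal{S}$ (the latter being the points of a line $\ell_\infty$); the lines are $\ell_\infty$ and the planes of $\mathrm{PG}(4,q)$ not contained in $\Sigma$ that meet $\Sigma$ in a line of $\mathcal{S}$; incidence is natural. Let $\sigma=2^{e+1}$. A Tits ovoid of $\mathrm{PG}(3,q)$ is a point set projectively equivalent to $\{(0,0,0,1)\}\cup\{(1,s,t,s^{\sigma+2}+t^\sigma+st) : s,t\in\mathbb{F}_q\}$. An ovoidal cone in $\mathrm{PG}(4,q)$ with vertex a point $V$ and base an ovoid $\mathcal{O}$ (contained in a hyperplane not through $V$) is the union of the lines joining $V$ to the points of $\mathcal{O}$. A Buekenhout-Tits unital in $\mathrm{PG}(2,q^2)$ is a unital arising, via the ABB construction, from an ovoidal cone $\mathcal{C}$ with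 base a Tits ovoid such that $\mathcal{C}\cap\Sigma$ is a line of the spread $\mathcal{S}$: it consists of the points of $\mathcal{C}\setminus\Sigma$ together with the point of $\ell_\infty$ corresponding to the spread line $\mathcal{C}\cap\Sigma$. *)

theory Defs
  imports "HOL-Analysis.Analysis"
begin

text \<open>
  Subspaces of the projective space over the vector space of column vectors are represented by
  linear subspaces, so that incidence is inclusion. The argument \<open>k\<close> is the
  projective dimension.
\<close>

definition proj_subspaces :: "nat \<Rightarrow> ('a::field ^ 'n::finite) set set" where
  "proj_subspaces k = {W. vec.subspace W \<and> vec.dim W = k + 1}"

abbreviation proj_points :: "('a::field ^ 'n::finite) set set" where
  "proj_points \<equiv> proj_subspaces 0"

abbreviation proj_lines :: "('a::field ^ 'n::finite) set set" where
  "proj_lines \<equiv> proj_subspaces 1"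

abbreviation proj_planes :: "('a::field ^ 'n::finite) set set" where
  "proj_planes \<equiv> proj_subspaces 2"

text \<open>The points contained in the subspace \<open>W\<close>.\<close>

definition points_in :: "('a::field ^ 'n::finite) set \<Rightarrow> ('a ^ 'n) set set" where
  "points_in W = {P \<in> proj_points. P \<subseteq> W}"

text \<open>
  The restriction to points identifies matrices that differ by a nonzero scalar.
\<close>

definition PGL :: "(('a::field ^ 'n::finite) set \<Rightarrow> ('a ^ 'n) set) set" where
  "PGL = {restrict (\<lambda>P. (*v) A ` P) proj_points | A :: 'a ^ 'n ^ 'n. invertible A}"


definition unital :: "nat \<Rightarrow> ('k::field ^ 3) set set \<Rightarrow> bool" where
  "unital q U \<longleftrightarrow>
     U \<subseteq> proj_points \<and> finite U \<and> card U = q ^ 3 + 1 \<and>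
     (\<forall>l \<in> proj_lines. card (U \<inter> points_in l) \<in> {1, q + 1})"


definition line_spread :: "('f::field ^ 5) set \<Rightarrow> ('f ^ 5) set set \<Rightarrow> bool" where
  "line_spread \<Sigma> S \<longleftrightarrow>
     S \<subseteq> {l \<in> proj_lines. l \<subseteq> \<Sigma>} \<and>
     (\<forall>P \<in> points_in \<Sigma>. \<exists>!l. l \<in> S \<and> P \<subseteq> l)"

text \<open>
  A spread is Desarguesian if it arises by field reduction: for an embedding \<open>\<iota>\<close> of
  the field \<open>'f\<close> into \<open>'k\<close>, the points of the projective line over
  \<open>'k\<close> are transferred to lines of \<open>\<Sigma>\<close> by an \<open>'f\<close>-linear
  isomorphism \<open>\<beta>\<close> from \<open>'k ^ 2\<close> onto \<open>\<Sigma>\<close>.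
\<close>

definition desarguesian_spread ::
    "'k::field itself \<Rightarrow> ('f::field ^ 5) set \<Rightarrow> ('f ^ 5) set set \<Rightarrow> bool" where
  "desarguesian_spread _ \<Sigma> S \<longleftrightarrow>
     line_spread \<Sigma> S \<and>
     (\<exists>(\<iota> :: 'f \<Rightarrow> 'k) (\<beta> :: 'k ^ 2 \<Rightarrow> 'f ^ 5).
        \<iota> 1 = 1 \<and> (\<forall>x y. \<iota> (x + y) = \<iota> x + \<iota> y) \<and> (\<forall>x y. \<iota> (x * y) = \<iota> x * \<iota> y) \<and>
        (\<forall>u v. \<beta> (u + v) = \<beta> u + \<beta> v) \<and> (\<forall>c v. \<beta> (\<iota> c *s v) = c *s \<beta> v) \<and>
        bij_betw \<beta> UNIV \<Sigma> \<and>
        S = (\<lambda>P. \<beta> ` P) ` proj_points)"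


definition abb_points :: "('f::field ^ 5) set \<Rightarrow> ('f ^ 5) set set \<Rightarrow> ('f ^ 5) set set" where
  "abb_points \<Sigma> S = (proj_points - points_in \<Sigma>) \<union> S"

text \<open>
  The line at infinity is represented by \<open>\<Sigma>\<close> itself: the points of the
  Andre/Bruck-Bose plane included in \<open>\<Sigma>\<close> are exactly the spread lines, so that
  incidence is inclusion for this line too.
\<close>

definition abb_lines :: "('f::field ^ 5) set \<Rightarrow> ('f ^ 5) set set \<Rightarrow> ('f ^ 5) set set" where
  "abb_lines \<Sigma> S = insert \<Sigma> {W \<in> proj_planes. \<not> W \<subseteq> \<Sigma> \<and> W \<inter> \<Sigma> \<in> S}"

text \<open>
  Isomorphisms of point-line geometries with inclusion as incidence, given by their action on
  points.
\<close>

definition incidence_iso ::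
    "'a set set \<Rightarrow> 'a set set \<Rightarrow> 'b set set \<Rightarrow> 'b set set \<Rightarrow> ('a set \<Rightarrow> 'b set) \<Rightarrow> bool" where
  "incidence_iso \<P> \<L> \<P>' \<L>' \<phi> \<longleftrightarrow>
     bij_betw \<phi> \<P> \<P>' \<and>
     (\<exists>\<psi>. bij_betw \<psi> \<L> \<L>' \<and> (\<forall>P \<in> \<P>. \<forall>l \<in> \<L>. \<phi> P \<subseteq> \<psi> l \<longleftrightarrow> P \<subseteq> l))"


definition standard_tits_ovoid :: "nat \<Rightarrow> ('f::field ^ 4) set set" where
  "standard_tits_ovoid \<sigma> =
     insert (vec.span {vector [0, 0, 0, 1]})
       {vec.span {vector [1, s, t, s ^ (\<sigma> + 2) + t ^ \<sigma> + s * t]} | s t. True}"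

text \<open>
  Tits ovoids of the hyperplane \<open>H\<close>, which is identified with the projective 3-space
  by linear isomorphisms.
\<close>

definition tits_ovoid_in :: "nat \<Rightarrow> ('f::field ^ 5) set \<Rightarrow> ('f ^ 5) set set \<Rightarrow> bool" where
  "tits_ovoid_in \<sigma> H Ov \<longleftrightarrow>
     (\<exists>T :: 'f ^ 4 \<Rightarrow> 'f ^ 5. Vector_Spaces.linear (*s) (*s) T \<and> bij_betw T UNIV H \<and>
        Ov = (\<lambda>P. T ` P) ` standard_tits_ovoid \<sigma>)"

definition cone :: "('f::field ^ 'n::finite) set \<Rightarrow> ('f ^ 'n) set set \<Rightarrow> ('f ^ 'n) set set" where
  "cone V B = (\<Union>Q \<in> B. points_in (vec.span (V \<union> Q)))"

definition tits_cone :: "nat \<Rightarrow> ('f::field ^ 5) set set \<Rightarrow> bool" where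
  "tits_cone \<sigma> C \<longleftrightarrow>
     (\<exists>V H Ov. V \<in> proj_points \<and> H \<in> proj_subspaces 3 \<and> \<not> V \<subseteq> H \<and>
        tits_ovoid_in \<sigma> H Ov \<and> C = cone V Ov)"


text \<open>
  The first argument fixes the field \<open>'f\<close> of the 4-space. The identification
  \<open>\<phi>\<close> of the Andre/Bruck-Bose plane with the Desarguesian plane over
  \<open>'k\<close> is an arbitrary isomorphism.
\<close>

definition buekenhout_tits_unital ::
    "'f::field itself \<Rightarrow> nat \<Rightarrow> ('k::field ^ 3) set set \<Rightarrow> bool" where
  "buekenhout_tits_unital _ e U \<longleftrightarrow>
     unital CARD('f) U \<and>
     (\<exists>(\<Sigma> :: ('f ^ 5) set) S \<phi> C l.
        \<Sigma> \<in> proj_subspaces 3 \<and>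
        desarguesian_spread TYPE('k) \<Sigma> S \<and>
        incidence_iso (abb_points \<Sigma> S) (abb_lines \<Sigma> S)
          (proj_points :: ('k ^ 3) set set) proj_lines \<phi> \<and>
        tits_cone (2 ^ (e + 1)) C \<and>
        l \<in> S \<and> C \<inter> points_in \<Sigma> = points_in l \<and>
        U = \<phi> ` insert l (C - points_in \<Sigma>))"

end

theory Submission
  imports Defs
begin

text \<open>
  Write \<open>K\<close> for the field of order \<open>q\<^sup>2\<close>, \<open>F\<close> for its subfield of order
  \<open>q\<close> and \<open>f(s, t) = s ^ (\<sigma> + 2) + t ^ \<sigma> + s t\<close>. The group of a Tits ovoid is
  transitive, so the point in which the ovoid touches \<open>\<Sigma>\<close> may be taken to be
  \<open>(0, 0, 0, 1)\<close>. In coordinates adapted to the cone, the Andre/Bruck-Bose isomorphism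
  then gives a unital consisting of \<open>(0, 0, 1)\<close> and the points
  \<open>(1, s + t y, r + f(s, t) \<gamma> + t w)\<close> with \<open>s, t, r \<in> F\<close>, for some
  \<open>y, \<gamma> \<in> K - F\<close> and \<open>w \<in> K\<close>. An arbitrary isomorphism differs from this one by a
  semilinear map, whose field automorphism preserves \<open>F\<close> and commutes with \<open>f\<close>, so it only
  changes \<open>y\<close>, \<open>\<gamma>\<close> and \<open>w\<close>. Finally the substitutions
  \<open>s \<mapsto> \<lambda> s + a\<close>, \<open>t \<mapsto> \<lambda> ^ (\<sigma> + 1) t + a ^ \<sigma> \<lambda> s\<close> change \<open>f\<close> by a scalar
  and an affine function and replace \<open>1 / y\<close> by \<open>(1 / y + a ^ \<sigma>) / \<lambda> ^ \<sigma>\<close>,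
  hence move \<open>y\<close> to any prescribed element of \<open>K - F\<close>; the other parameters are removed
  by the map \<open>z \<mapsto> \<xi> z + \<tau> x + \<kappa>\<close> of the third coordinate.
\<close>

section \<open>Finite fields of characteristic 2 and the Tits polynomial\<close>

definition tits_poly :: "nat \<Rightarrow> 'a::field \<Rightarrow> 'a \<Rightarrow> 'a" where
  "tits_poly \<sigma> s t = s ^ (\<sigma> + 2) + t ^ \<sigma> + s * t"

text \<open>Multiplication by a nonzero \<open>x\<close> permutes the nonzero elements; comparing
  their product before and after cancels to \<open>x ^ (CARD('a) - 1) = 1\<close>.\<close>

lemma finite_field_power_card:
  fixes x :: "'a::{field,finite}"
  shows "x ^ CARD('a) = x"
proof (cases "x = 0")
  case True
  then show ?thesis by simp
next
  case False
  have "(\<Prod>y\<in>UNIV-{0}. x * y) = (\<Prod>y\<in>UNIV-{0}. y)"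
    by (rule prod.reindex_bij_witness[of _ "\<lambda>y. y / x" "\<lambda>y. x * y"]) (use False in auto)
  then have "x ^ card (UNIV - {0::'a}) = 1"
    by (simp add: prod.distrib)
  moreover have "CARD('a) = Suc (card (UNIV - {0::'a}))"
    by (metis UNIV_I card_Suc_Diff1 finite)
  ultimately show ?thesis by (metis mult_1_right power_Suc)
qed

text \<open>Translation by 1 permutes the field, so summing all elements shows that the cardinality,
  a power of 2, vanishes in the field.\<close>

lemma one_plus_one_eq_0_if_card_power_2:
  assumes "CARD('a::{field,finite}) = 2 ^ n"
  shows "(1::'a) + 1 = 0"
proof -
  have "(\<Sum>x\<in>(UNIV::'a set). x + 1) = (\<Sum>x\<in>(UNIV::'a set). x)"
    by (rule sum.reindex_bij_witness[of _ "\<lambda>y. y - 1" "\<lambda>y. y + 1"]) auto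
  then have "of_nat CARD('a) = (0::'a)"
    by (simp add: sum.distrib)
  then have "(2::'a) ^ n = 0"
    using assms by (metis of_nat_numeral of_nat_power)
  then show ?thesis by simp
qed

text \<open>The characteristic of \<open>'k\<close> is fixed but not its size: the locale is
  interpreted both for the field of order \<open>q\<^sup>2\<close> and for the field of order
  \<open>q\<close>, where \<open>F0\<close> is everything.\<close>

locale suzuki_field =
  fixes e q :: nat and ty :: "'k::field itself"
  assumes two_eq_0: "1 + 1 = (0::'k)"
    and q_eq: "q = 2 ^ (2 * e + 1)"
begin

definition \<sigma> :: nat where "\<sigma> = 2 ^ (e + 1)"

text \<open>Fixed points of a power map rather than the range of an embedding: this does not refer
  to a choice of embedding and is visibly respected by field endomorphisms.\<close>

definition F0 :: "'k set" where "F0 = {x. x ^ q = x}"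

lemma add_self [simp]: "x + x = (0::'k)"
  by (metis mult_2 mult_zero_left one_add_one two_eq_0)

lemma minus_eq [simp]: "- x = (x::'k)"
  by (simp add: minus_unique)

lemma diff_eq_add: "x - y = x + (y::'k)"
  by (metis diff_conv_add_uminus minus_eq)

lemma power_two_power_add: "(x + y) ^ (2 ^ n) = x ^ (2 ^ n) + (y::'k) ^ (2 ^ n)"
proof (induction n)
  case (Suc n)
  have "(a + b)\<^sup>2 = a\<^sup>2 + b\<^sup>2" for a b :: 'k
    using two_eq_0[unfolded one_add_one] by (simp add: power2_sum)
  with Suc show ?case
    by (simp add: power_mult mult.commute[of 2])
qed simp

lemma sigma_add: "(x + y) ^ \<sigma> = x ^ \<sigma> + (y::'k) ^ \<sigma>"
  unfolding \<sigma>_def by (rule power_two_power_add)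

lemma sigma_nonzero [simp]: "\<sigma> \<noteq> 0"
  by (simp add: \<sigma>_def)

lemma add_self_left [simp]: "x + (x + y) = (y::'k)"
  by (simp flip: add.assoc)

lemmas char_2_simps = algebra_simps diff_eq_add power2_eq_square

lemma F0_closed [simp, intro]:
  "0 \<in> F0" "1 \<in> F0" "x \<in> F0 \<Longrightarrow> y \<in> F0 \<Longrightarrow> x + y \<in> F0"
  "x \<in> F0 \<Longrightarrow> y \<in> F0 \<Longrightarrow> x - y \<in> F0"
  "x \<in> F0 \<Longrightarrow> y \<in> F0 \<Longrightarrow> x * y \<in> F0" "x \<in> F0 \<Longrightarrow> y \<in> F0 \<Longrightarrow> x / y \<in> F0"
  "x \<in> F0 \<Longrightarrow> x ^ n \<in> F0"
proof -
  have q0: "q \<noteq> 0" by (simp add: q_eq)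
  show "0 \<in> F0" "1 \<in> F0" using q0 by (auto simp: F0_def)
  show a: "x + y \<in> F0" if "x \<in> F0" "y \<in> F0" for x y
    using that power_two_power_add[of x y "2 * e + 1", folded q_eq] by (simp add: F0_def)
  show "x \<in> F0 \<Longrightarrow> y \<in> F0 \<Longrightarrow> x - y \<in> F0" using a by (simp add: diff_eq_add)
  show "x \<in> F0 \<Longrightarrow> y \<in> F0 \<Longrightarrow> x * y \<in> F0" by (auto simp: F0_def power_mult_distrib)
  show "x \<in> F0 \<Longrightarrow> y \<in> F0 \<Longrightarrow> x / y \<in> F0" by (auto simp: F0_def power_divide)
  show "x \<in> F0 \<Longrightarrow> x ^ n \<in> F0"
    by (auto simp: F0_def) (metis power_mult mult.commute)
qed

section \<open>The Tits endomorphism and symmetries of the ovoid polynomial\<close>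

lemma tits_poly_F0 [simp]: "s \<in> F0 \<Longrightarrow> t \<in> F0 \<Longrightarrow> tits_poly n s t \<in> F0"
  by (simp add: tits_poly_def del: power_Suc power_add)

text \<open>Since \<open>\<sigma> * \<sigma> = 2 * q\<close>, the \<sigma>-power map is a square
  root of the Frobenius map on \<open>F0\<close>.\<close>

lemma sigma_sigma: "x \<in> F0 \<Longrightarrow> (x ^ \<sigma>) ^ \<sigma> = x\<^sup>2"
proof -
  assume "x \<in> F0"
  have "\<sigma> * \<sigma> = q * 2"
    by (simp add: q_eq \<sigma>_def flip: power_add power_Suc2)
  then have "(x ^ \<sigma>) ^ \<sigma> = (x ^ q) ^ 2"
    by (simp only: power_mult[symmetric])
  then show ?thesis using \<open>x \<in> F0\<close> by (simp add: F0_def)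
qed

lemma sigma_root:
  assumes "x \<in> F0"
  obtains y where "y \<in> F0" "y ^ \<sigma> = x"
proof
  \<comment> \<open>The exponent comes from \<open>(3 * e + 1) + (e + 1) = 2 * (2 * e + 1)\<close>;
    the composite power map is the identity on \<open>F0\<close>.\<close>
  have "2 ^ (3 * e + 1) * \<sigma> = q * q"
    by (simp add: q_eq \<sigma>_def flip: power_add)
  then have "(x ^ (2 ^ (3 * e + 1))) ^ \<sigma> = (x ^ q) ^ q"
    by (simp only: power_mult[symmetric])
  then show "(x ^ (2 ^ (3 * e + 1))) ^ \<sigma> = x"
    using assms by (simp add: F0_def)
qed (use assms in simp)

text \<open>The shear term \<open>a ^ \<sigma> * l * s\<close> makes the terms in
  \<open>s ^ \<sigma>\<close> and \<open>s\<^sup>2\<close> cancel in pairs, so only a scalar and an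
  affine function remain. With \<open>l = 1\<close> these are the translations of the ovoid.\<close>

lemma tits_poly_substitution:
  assumes "l \<in> F0" "a \<in> F0"
  shows "tits_poly \<sigma> (l * s + a) (l * l ^ \<sigma> * t + a ^ \<sigma> * l * s + b) =
    l * l * l ^ \<sigma> * tits_poly \<sigma> s t + tits_poly \<sigma> a b
      + (b * l + a * a ^ \<sigma> * l) * s + a * l * l ^ \<sigma> * t"
proof -
  have 1: "(l * l ^ \<sigma> * t + a ^ \<sigma> * l * s + b) ^ \<sigma> = l ^ \<sigma> * l\<^sup>2 * t ^ \<sigma> + a\<^sup>2 * l ^ \<sigma> * s ^ \<sigma> + b ^ \<sigma>"
    using assms by (simp only: sigma_add power_mult_distrib sigma_sigma)
  have 2: "(l * s + a) ^ \<sigma> = l ^ \<sigma> * s ^ \<sigma> + a ^ \<sigma>"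
    by (simp only: sigma_add power_mult_distrib)
  show ?thesis
    unfolding tits_poly_def power_add 1 2 by (simp add: char_2_simps)
qed

text \<open>Reversing \<open>(1, s, t, f)\<close> gives \<open>(f, t, s, 1)\<close>, that is
  \<open>(1, t / f, s / f, 1 / f)\<close>; the identity says that this point is again on the
  ovoid.\<close>

lemma tits_poly_swap:
  assumes "s \<in> F0" "t \<in> F0" and f: "tits_poly \<sigma> s t \<noteq> 0" (is "?f \<noteq> 0")
  shows "tits_poly \<sigma> (t / ?f) (s / ?f) = 1 / ?f"
proof -
  have f\<sigma>: "?f ^ \<sigma> = s\<^sup>2 * (s ^ \<sigma>)\<^sup>2 + t\<^sup>2 + s ^ \<sigma> * t ^ \<sigma>"
  proof -
    have "?f ^ \<sigma> = (s ^ \<sigma>) ^ \<sigma> * (s\<^sup>2) ^ \<sigma> + (t ^ \<sigma>) ^ \<sigma> + s ^ \<sigma> * t ^ \<sigma>"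
      unfolding tits_poly_def power_add by (simp only: sigma_add power_mult_distrib)
    moreover have "(s\<^sup>2) ^ \<sigma> = (s ^ \<sigma>)\<^sup>2" by (simp add: mult.commute flip: power_mult)
    ultimately show ?thesis using assms(1,2) by (simp only: sigma_sigma)
  qed
  have "t ^ \<sigma> * t\<^sup>2 + s ^ \<sigma> * ?f\<^sup>2 + s * t * ?f ^ \<sigma> = ?f * ?f ^ \<sigma>"
    unfolding f\<sigma> unfolding tits_poly_def power_add by (simp add: char_2_simps)
  \<comment> \<open>The \<sigma>-powers of \<open>s\<close>, \<open>t\<close> and the polynomial
    become independent letters \<open>S\<close>, \<open>T\<close>, \<open>F\<close>, leaving a
    purely rational identity.\<close>
  moreover have "T / F * (t\<^sup>2 / G\<^sup>2) + S / F + t / G * (s / G) = 1 / G"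
    if "T * t\<^sup>2 + S * G\<^sup>2 + s * t * F = G * F" "F \<noteq> 0" "G \<noteq> 0" for S T F G :: 'k
  proof -
    have "T / F * (t\<^sup>2 / G\<^sup>2) + S / F + t / G * (s / G) = (T * t\<^sup>2 + S * G\<^sup>2 + s * t * F) / (F * G\<^sup>2)"
      using that(2,3) by (simp add: field_simps power2_eq_square)
    also have "\<dots> = 1 / G" unfolding that(1) using that(2,3) by (simp add: power2_eq_square)
    finally show ?thesis .
  qed
  ultimately show ?thesis using f
    unfolding tits_poly_def[of _ "t / ?f"] power_add by (simp only: power_divide power_eq_0_iff) simp
qed

text \<open>A zero with nonzero \<open>s\<close> gives \<open>u = t / s ^ (\<sigma> + 1)\<close>
  with \<open>u ^ \<sigma> + u + 1 = 0\<close>. Its \<sigma>-power is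
  \<open>u\<^sup>2 + u ^ \<sigma> + 1 = 0\<close>; adding both yields \<open>u\<^sup>2 = u\<close>,
  but neither 0 nor 1 is a solution.\<close>

lemma tits_poly_eq_0_iff:
  assumes "s \<in> F0" "t \<in> F0"
  shows "tits_poly \<sigma> s t = 0 \<longleftrightarrow> s = 0 \<and> t = 0"
proof
  assume f: "tits_poly \<sigma> s t = 0"
  show "s = 0 \<and> t = 0"
  proof (cases "s = 0")
    case True
    with f show ?thesis by (simp add: tits_poly_def)
  next
    case False
    define u where "u = t / (s ^ \<sigma> * s)"
    have u: "u \<in> F0" using assms by (auto simp: u_def)
    have t: "t = u * (s ^ \<sigma> * s)" using False by (simp add: u_def)
    have "tits_poly \<sigma> s t = s ^ \<sigma> * s\<^sup>2 * (1 + u ^ \<sigma> + u)"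
      unfolding tits_poly_def t power_add power_mult_distrib sigma_sigma[OF assms(1)]
      by (simp add: algebra_simps power2_eq_square)
    with f False have 1: "1 + u ^ \<sigma> + u = 0" by simp
    then have "(1 + u ^ \<sigma> + u) ^ \<sigma> = 0" by (simp add: power_0_left)
    then have "1 + u\<^sup>2 + u ^ \<sigma> = 0"
      by (simp only: sigma_add sigma_sigma[OF u] power_one)
    then have "(1 + u\<^sup>2 + u ^ \<sigma>) + (1 + u ^ \<sigma> + u) = 0" using 1 by simp
    then have "u * (u + 1) = 0" by (simp add: char_2_simps)
    then have "u = 0 \<or> u = 1" by (simp add: add_eq_0_iff2)
    with 1 have False by (auto simp: power_0_left)
    then show ?thesis ..
  qed
qed (auto simp: tits_poly_def power_0_left)

section \<open>Normalization of the parameters of a unital\<close>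

definition bt_vector :: "'k \<Rightarrow> 'k \<Rightarrow> 'k \<Rightarrow> 'k \<Rightarrow> 'k \<Rightarrow> 'k \<Rightarrow> 'k ^ 3" where
  "bt_vector y \<gamma> w s t r = vector [1, s + t * y, r + tits_poly \<sigma> s t * \<gamma> + t * w]"

text \<open>The substitution of \<open>tits_poly_substitution\<close> with \<open>b = 0\<close> is
  inverted. The second row of \<open>M\<close> adjusts \<open>y\<close>; the third removes
  \<open>w\<close> and the affine terms and turns \<open>\<gamma>\<close> into
  \<open>\<epsilon>\<close>, working in the basis \<open>1, \<epsilon>\<close> over
  \<open>F0\<close>.\<close>

lemma bt_vector_normalization:
  assumes \<epsilon>: "\<And>x. \<exists>a\<in>F0. \<exists>b\<in>F0. x = a + b * \<epsilon>" and y: "y \<notin> F0" and \<gamma>: "\<gamma> \<notin> F0"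
  obtains M :: "'k ^ 3 ^ 3" and \<xi> where "invertible M" "\<xi> \<noteq> 0"
    "M *v vector [0, 0, 1] = \<xi> *s vector [0, 0, 1]"
    "\<And>s t r. s \<in> F0 \<Longrightarrow> t \<in> F0 \<Longrightarrow> r \<in> F0 \<Longrightarrow>
      \<exists>s'\<in>F0. \<exists>t'\<in>F0. \<exists>r'\<in>F0. bt_vector y \<gamma> w s t r = M *v bt_vector \<epsilon> \<epsilon> 0 s' t' r'"
proof -
  \<comment> \<open>Equivalently \<open>u * y = (1 + v * y) * \<epsilon>\<close>, which makes the
    coefficient \<open>l * u * y\<close> of \<open>t'\<close> equal to
    \<open>\<mu> * \<epsilon>\<close>. The parameters \<open>l\<close> and \<open>a\<close> are then
    \<sigma>-roots of \<open>u\<close> and \<open>v\<close>.\<close>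
  obtain u v where uv: "u \<in> F0" "v \<in> F0" "\<epsilon> / y = u + v * \<epsilon>" using \<epsilon>[of "\<epsilon> / y"] by auto
  have y0: "y \<noteq> 0" using y by auto
  have uy: "u * y = (1 + v * y) * \<epsilon>"
  proof -
    have "\<epsilon> = u * y + v * \<epsilon> * y" using uv(3) y0 by (simp add: field_simps)
    then have "u * y = \<epsilon> + v * \<epsilon> * y" using add_self_left[of "v * \<epsilon> * y" "u * y"]
      by (simp add: add.commute)
    then show ?thesis by (simp add: algebra_simps)
  qed
  have "\<epsilon> \<notin> F0" using \<epsilon>[of y] y by auto
  then have \<epsilon>0: "\<epsilon> \<noteq> 0" by auto
  have "u \<noteq> 0"
  proof
    assume "u = 0"
    then have "1 = v * y" using uv(3) \<epsilon>0 y0 by (simp add: field_simps)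
    then have "y = 1 / v" by (metis mult_zero_left nonzero_eq_divide_eq one_neq_zero mult.commute)
    then show False using y uv F0_closed by metis
  qed
  obtain l where l: "l \<in> F0" "l ^ \<sigma> = u" using sigma_root uv(1) by blast
  obtain a where a: "a \<in> F0" "a ^ \<sigma> = v" using sigma_root uv(2) by blast
  have l0: "l \<noteq> 0" using l \<open>u \<noteq> 0\<close> by (auto simp: power_0_left)
  obtain g0 c where g: "g0 \<in> F0" "c \<in> F0" "\<gamma> = g0 + c * \<epsilon>" using \<epsilon>[of \<gamma>] by auto
  have c0: "c \<noteq> 0" using g \<gamma> by auto
  obtain w0 w1 where w: "w0 \<in> F0" "w1 \<in> F0" "w = w0 + w1 * \<epsilon>" using \<epsilon>[of w] by auto
  obtain e0 e1 where ee: "e0 \<in> F0" "e1 \<in> F0" "\<epsilon> * \<epsilon> = e0 + e1 * \<epsilon>" using \<epsilon>[of "\<epsilon> * \<epsilon>"] by auto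
  \<comment> \<open>The \<epsilon>-component of the third coordinate is
    \<open>c * tits_poly \<sigma> s t + w1 * t\<close>. Written in \<open>s'\<close> and
    \<open>t'\<close>, it has coefficients \<open>\<xi>\<close>, \<open>\<alpha>\<close>,
    \<open>\<beta>\<close> at \<open>tits_poly \<sigma> s' t'\<close>, \<open>s'\<close>,
    \<open>t'\<close>.\<close>
  define \<xi> where "\<xi> = c * (l * l * u)"
  define \<alpha> where "\<alpha> = c * a * v * l + w1 * v * l"
  define \<beta> where "\<beta> = c * a * l * u + w1 * l * u"
  \<comment> \<open>The correction \<open>\<alpha> * e1\<close> compensates for
    \<open>\<epsilon> * \<epsilon> = e0 + e1 * \<epsilon>\<close>, so that
    \<open>\<tau> * (s' + t' * \<epsilon>)\<close> has \<epsilon>-component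
    \<open>\<alpha> * s' + \<beta> * t'\<close>.\<close>
  define \<tau>0 where "\<tau>0 = \<beta> - \<alpha> * e1"
  define \<tau> where "\<tau> = \<tau>0 + \<alpha> * \<epsilon>"
  define \<mu> where "\<mu> = l * (1 + v * y)"
  define M :: "'k ^ 3 ^ 3" where
    "M = vector [vector [1, 0, 0], vector [a, \<mu>, 0], vector [c * tits_poly \<sigma> a 0 * \<epsilon>, \<tau>, \<xi>]]"
  have mem: "\<xi> \<in> F0" "\<alpha> \<in> F0" "\<beta> \<in> F0" "\<tau>0 \<in> F0"
    using g w ee l a uv by (auto simp: \<xi>_def \<alpha>_def \<beta>_def \<tau>0_def)
  have \<xi>0: "\<xi> \<noteq> 0" using c0 l0 \<open>u \<noteq> 0\<close> by (simp add: \<xi>_def)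
  have "\<mu> \<noteq> 0" using uy \<open>u \<noteq> 0\<close> y0 l0 by (auto simp: \<mu>_def)
  show ?thesis
  proof (rule that)
    show "\<xi> \<noteq> 0" by fact
    show "invertible M"
      unfolding invertible_det_nz using \<xi>0 \<open>\<mu> \<noteq> 0\<close> by (simp add: M_def det_3)
    show "M *v vector [0, 0, 1] = \<xi> *s vector [0, 0, 1]"
      by (simp add: M_def vec_eq_iff forall_3 matrix_vector_mult_def sum_3)
    fix s t r assume str: "s \<in> F0" "t \<in> F0" "r \<in> F0"
    define s' where "s' = (s - a) / l"
    define t' where "t' = (t - v * l * s') / (l * u)"
    \<comment> \<open>As \<open>r'\<close> may be any element of \<open>F0\<close>, it absorbs every
      remaining term of the \<open>F0\<close>-component.\<close>
    define r' where "r' = (r + tits_poly \<sigma> s t * g0 + t * w0 - \<tau>0 * s' - \<alpha> * e0 * t') / \<xi>"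
    have mem': "s' \<in> F0" "t' \<in> F0" "r' \<in> F0"
      using str a l uv mem ee g w
      by (simp_all add: s'_def t'_def r'_def)
    have s: "s = l * s' + a" using l0 by (simp add: s'_def)
    have t: "t = l * u * t' + v * l * s'" using l0 \<open>u \<noteq> 0\<close> by (simp add: t'_def)
    have r: "\<xi> * r' = r + tits_poly \<sigma> s t * g0 + t * w0 - \<tau>0 * s' - \<alpha> * e0 * t'"
      using \<xi>0 by (simp add: r'_def)
    have f: "tits_poly \<sigma> s t = l * l * u * tits_poly \<sigma> s' t' + tits_poly \<sigma> a 0
      + a * v * l * s' + a * l * u * t'"
      using tits_poly_substitution[OF l(1) a(1), of s' t' 0] by (simp add: s t l a)
    have 1: "s + t * y = a + \<mu> * (s' + t' * \<epsilon>)"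
      unfolding s t \<mu>_def using uy by algebra
    have 2: "r + tits_poly \<sigma> s t * \<gamma> + t * w =
      c * tits_poly \<sigma> a 0 * \<epsilon> + \<tau> * (s' + t' * \<epsilon>) + \<xi> * (r' + tits_poly \<sigma> s' t' * \<epsilon>)" (is "?l = ?r")
    proof -
      have "?r = \<xi> * r' + (\<tau>0 * s' + \<alpha> * t' * e0)
        + (c * tits_poly \<sigma> a 0 + \<xi> * tits_poly \<sigma> s' t' + \<alpha> * s' + \<beta> * t') * \<epsilon>"
        unfolding \<tau>_def \<tau>0_def using ee(3) by algebra
      moreover have "\<xi> * r' + (\<tau>0 * s' + \<alpha> * t' * e0) = r + tits_poly \<sigma> s t * g0 + t * w0"
        unfolding r by (simp add: mult_ac)
      moreover have "c * tits_poly \<sigma> a 0 + \<xi> * tits_poly \<sigma> s' t' + \<alpha> * s' + \<beta> * t' = c * tits_poly \<sigma> s t + w1 * t"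
        unfolding f \<xi>_def \<alpha>_def \<beta>_def by (simp add: algebra_simps t)
      ultimately have "?r = r + tits_poly \<sigma> s t * g0 + t * w0 + (c * tits_poly \<sigma> s t + w1 * t) * \<epsilon>"
        by (simp only:)
      also have "\<dots> = ?l" unfolding g w by (simp add: algebra_simps)
      finally show ?thesis ..
    qed
    have "bt_vector y \<gamma> w s t r = M *v bt_vector \<epsilon> \<epsilon> 0 s' t' r'"
      using 1 2 by (simp add: M_def bt_vector_def vec_eq_iff forall_3 matrix_vector_mult_def sum_3)
    then show "\<exists>s'\<in>F0. \<exists>t'\<in>F0. \<exists>r'\<in>F0. bt_vector y \<gamma> w s t r = M *v bt_vector \<epsilon> \<epsilon> 0 s' t' r'"
      using mem' by blast
  qed
qed

end

section \<open>Collineations of the projective plane\<close>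

lemma vec_dim_complement:
  fixes L W :: "('a::field ^ 'n) set"
  assumes "vec.subspace L" "vec.subspace W" "L \<subseteq> W" "p \<in> W" "p \<notin> L"
    and "\<And>x. x \<in> W \<Longrightarrow> \<exists>k. x - k *s p \<in> L"
  shows "vec.dim W = vec.dim L + 1"
proof -
  have span: "vec.span L = L" using assms(1) by (simp only: vec.span_eq_iff)
  have "W \<subseteq> vec.span (insert p L)"
    using assms(6) by (auto simp only: vec.span_breakdown_eq span)
  moreover have "vec.span (insert p L) \<subseteq> W"
    using assms by (intro vec.span_minimal) auto
  ultimately have "W = vec.span (insert p L)" by (rule equalityI)
  then have "vec.dim W = vec.dim (insert p L)" by (simp only: vec.dim_span)
  then show ?thesis
    using assms(5) by (simp only: vec.dim_insert span if_False)
qed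

text \<open>Every vector is uniquely a multiple of \<open>p\<close> plus an element of
  \<open>W\<close>; the functional reads off that multiple.\<close>

lemma hyperplane_functional:
  fixes W :: "('a::field ^ 'n) set"
  assumes W: "vec.subspace W" "vec.dim W + 1 = CARD('n)" and p: "p \<notin> W"
  obtains f where "\<And>x y. f (x + y) = f x + f y" "\<And>c x. f (c *s x) = c * f x"
    "\<And>x. f x = 0 \<longleftrightarrow> x \<in> W" "f p = (1::'a)"
proof -
  have span: "vec.span W = W" using W(1) by (simp only: vec.span_eq_iff)
  have "vec.dim (insert p W) = CARD('n)"
    using W(2) p by (simp only: vec.dim_insert span if_False)
  then have "vec.span (insert p W) = UNIV"
    using vec.dim_eq_span[of "insert p W" UNIV] by (simp only: vec_dim_card vec.span_UNIV order_refl subset_UNIV simp_thms)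
  then have ex: "\<exists>k. x - k *s p \<in> W" for x
    using vec.span_breakdown_eq[of x p W] unfolding span by blast
  have unique: "k = k'" if "x - k *s p \<in> W" "x - k' *s p \<in> W" for x k k'
  proof (rule ccontr)
    assume "k \<noteq> k'"
    have "(k' - k) *s p \<in> W"
      using vec.subspace_diff[OF W(1) that] by (simp add: vec.scale_left_diff_distrib)
    then have "(1 / (k' - k)) *s ((k' - k) *s p) \<in> W"
      by (rule vec.subspace_scale[OF W(1)])
    with \<open>k \<noteq> k'\<close> p show False by (simp only: vec.scale_scale) simp
  qed
  define f where "f x = (THE k. x - k *s p \<in> W)" for x
  have f: "x - f x *s p \<in> W" for x
    unfolding f_def by (rule theI') (use ex unique in blast)
  have fI: "f x = k" if "x - k *s p \<in> W" for x k
    using unique[OF f that] .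
  show ?thesis
  proof (rule that)
    show "f (x + y) = f x + f y" for x y
      using vec.subspace_add[OF W(1) f[of x] f[of y]]
      by (intro fI) (simp only: vec.scale_left_distrib add_diff_add)
    show "f (c *s x) = c * f x" for c x
      using vec.subspace_scale[OF W(1) f[of x], of c]
      by (intro fI) (simp only: vec.scale_right_diff_distrib vec.scale_scale)
    show "f x = 0 \<longleftrightarrow> x \<in> W" for x
      using f[of x] fI[of x 0] by auto
    show "f p = 1" by (intro fI) (simp add: vec.subspace_0[OF W(1)])
  qed
qed

section \<open>Collinearity through determinants and line coordinates\<close>

definition triple :: "'a::field ^ 3 \<Rightarrow> 'a ^ 3 \<Rightarrow> 'a ^ 3 \<Rightarrow> 'a" where
  "triple u v w = det (vector [u, v, w])"

lemma triple_expand: "triple u v w =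
    u$1 * v$2 * w$3 + u$2 * v$3 * w$1 + u$3 * v$1 * w$2
    - u$1 * v$3 * w$2 - u$2 * v$1 * w$3 - u$3 * v$2 * w$1"
  by (simp add: triple_def det_3)

text \<open>A nonzero \<open>n\<close> serves as homogeneous coordinates of the line on which the
  pairing vanishes.\<close>

definition pairing :: "'a::field ^ 3 \<Rightarrow> 'a ^ 3 \<Rightarrow> 'a" where
  "pairing n x = n$1 * x$1 + n$2 * x$2 + n$3 * x$3"

lemma pairing_add: "pairing n (x + y) = pairing n x + pairing n y"
  and pairing_scale: "pairing n (c *s x) = c * pairing n x"
  and pairing_diff: "pairing n (x - y) = pairing n x - pairing n y"
  and pairing_0 [simp]: "pairing n 0 = 0"
  by (simp_all add: pairing_def algebra_simps)

text \<open>The vector \<open>n\<close> is a kernel vector of the matrix with rows \<open>u\<close>,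
  \<open>v\<close>, \<open>w\<close>.\<close>

lemma triple_eq_0_iff_pairing:
  "triple u v w = 0 \<longleftrightarrow> (\<exists>n. n \<noteq> 0 \<and> pairing n u = 0 \<and> pairing n v = 0 \<and> pairing n w = 0)"
proof -
  let ?M = "vector [u, v, w] :: 'a ^ 3 ^ 3"
  have "det ?M \<noteq> 0 \<longleftrightarrow> (\<forall>n. ?M *v n = 0 \<longrightarrow> n = 0)"
    by (simp only: invertible_det_nz[symmetric] invertible_left_inverse matrix_left_invertible_ker)
  then have "triple u v w = 0 \<longleftrightarrow> (\<exists>n. n \<noteq> 0 \<and> ?M *v n = 0)"
    unfolding triple_def by blast
  moreover have "?M *v n = 0 \<longleftrightarrow> pairing n u = 0 \<and> pairing n v = 0 \<and> pairing n w = 0" for n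
    by (simp add: pairing_def vec_eq_iff forall_3 matrix_vector_mult_def sum_3 mult.commute)
  ultimately show ?thesis by (simp only:)
qed

lemma pairing_nondegenerate:
  assumes "n \<noteq> 0" obtains x where "pairing n x \<noteq> 0"
proof -
  obtain i where i: "n $ i \<noteq> 0" using assms by (auto simp: vec_eq_iff)
  have "pairing n (axis i 1) = n $ i"
    using exhaust_3[of i] by (auto simp: axis_def pairing_def)
  with i have "pairing n (axis i 1) \<noteq> 0" by simp
  then show ?thesis by (rule that)
qed

lemma kernel_in_proj_lines:
  fixes n :: "'a::field ^ 3"
  assumes "n \<noteq> 0"
  shows "{x. pairing n x = 0} \<in> proj_lines"
proof -
  let ?l = "{x. pairing n x = 0}"
  have sub: "vec.subspace ?l"
    by (rule vec.subspaceI) (simp_all add: pairing_add pairing_scale)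
  obtain p where p: "pairing n p \<noteq> 0" using pairing_nondegenerate[OF assms] .
  have "vec.dim (UNIV :: ('a ^ 3) set) = vec.dim ?l + 1"
  proof (rule vec_dim_complement[OF sub])
    show "p \<notin> ?l" using p by simp
    show "\<exists>k. x - k *s p \<in> ?l" for x
      using p by (intro exI[of _ "pairing n x / pairing n p"]) (simp add: pairing_diff pairing_scale)
  qed simp_all
  then have "vec.dim ?l = 2"
    using vec_dim_card[where ?'a='a and ?'n=3] by simp
  then show ?thesis using sub by (simp add: proj_subspaces_def)
qed

text \<open>The kernel of a common functional is a line. Conversely, a nonzero determinant would
  make the three rows span the whole space and not just a line.\<close>

lemma triple_eq_0_iff_line:
  "triple u v w = 0 \<longleftrightarrow> (\<exists>l \<in> proj_lines. u \<in> l \<and> v \<in> l \<and> w \<in> l)"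
proof
  assume "triple u v w = 0"
  then obtain n where "n \<noteq> 0" "pairing n u = 0" "pairing n v = 0" "pairing n w = 0"
    unfolding triple_eq_0_iff_pairing by (elim exE conjE)
  then show "\<exists>l \<in> proj_lines. u \<in> l \<and> v \<in> l \<and> w \<in> l"
    by (intro bexI[OF _ kernel_in_proj_lines]) simp_all
next
  assume "\<exists>l \<in> proj_lines. u \<in> l \<and> v \<in> l \<and> w \<in> l"
  then obtain l where l: "vec.subspace l" "vec.dim l = 2" "u \<in> l" "v \<in> l" "w \<in> l"
    by (auto simp: proj_subspaces_def)
  show "triple u v w = 0"
  proof (rule ccontr)
    let ?M = "vector [u, v, w] :: 'a ^ 3 ^ 3"
    assume "triple u v w \<noteq> 0"
    then have "vec.span (rows ?M) = UNIV"
      by (simp only: triple_def invertible_det_nz[symmetric] invertible_left_inverse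
          matrix_left_invertible_span_rows_gen)
    moreover have "rows ?M \<subseteq> l"
    proof
      fix x assume "x \<in> rows ?M"
      then obtain i where "x = row i ?M" by (auto simp: rows_def)
      then have "x = ?M $ i" by (simp add: row_def)
      then show "x \<in> l" using exhaust_3[of i] l by auto
    qed
    ultimately have "l = UNIV" using vec.span_minimal[of "rows ?M" l] l(1) by (simp only: top_unique)
    then show False using l(2) vec_dim_card[where ?'a='a and ?'n=3] by simp
  qed
qed

lemma triple_matrix_vector_mult: "triple (A *v u) (A *v v) (A *v w) = det A * triple u v w"
proof -
  let ?M = "vector [u, v, w] :: 'a ^ 3 ^ 3"
  have "vector [A *v u, A *v v, A *v w] $ i = (?M ** transpose A) $ i" for i :: 3
    using exhaust_3[of i]
    by (auto simp: vec_eq_iff matrix_vector_mult_def matrix_matrix_mult_def transpose_def sum_3 mult.commute)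
  then have "vector [A *v u, A *v v, A *v w] = ?M ** transpose A"
    by (simp only: vec_eq_iff simp_thms)
  then show ?thesis
    unfolding triple_def by (simp only: det_mul det_transpose mult.commute)
qed

text \<open>
  The images of the points of slope \<open>m\<close> on the line at infinity and of the points on
  the line \<open>z = m x + b\<close> show at once that \<open>\<theta>\<close> is additive and
  multiplicative.
\<close>

lemma collineation_semilinear_normalized:
  fixes \<kappa> :: "'k::field ^ 3 \<Rightarrow> 'k ^ 3"
  assumes coll: "\<And>u v w. u \<noteq> 0 \<Longrightarrow> v \<noteq> 0 \<Longrightarrow> w \<noteq> 0 \<Longrightarrow>
      triple (\<kappa> u) (\<kappa> v) (\<kappa> w) = 0 \<longleftrightarrow> triple u v w = 0"
    and frame: "\<kappa> (vector [1, 0, 0]) = vector [a1, 0, 0]" "\<kappa> (vector [0, 1, 0]) = vector [0, a2, 0]"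
      "\<kappa> (vector [0, 0, 1]) = vector [0, 0, a3]" "\<kappa> (vector [1, 1, 1]) = vector [1, 1, 1]"
      "a1 \<noteq> 0" "a2 \<noteq> 0" "a3 \<noteq> 0"
  obtains \<theta> :: "'k \<Rightarrow> 'k"
  where "\<theta> 1 = 1" "\<And>x y. \<theta> (x + y) = \<theta> x + \<theta> y" "\<And>x y. \<theta> (x * y) = \<theta> x * \<theta> y"
    "\<And>x z. \<exists>c. c \<noteq> 0 \<and> \<kappa> (vector [1, x, z]) = c *s vector [1, \<theta> x, \<theta> z]"
proof -
  let ?p = "\<lambda>x y z. vector [x, y, z] :: 'k ^ 3"
  have nz: "?p 1 x z \<noteq> 0" "?p 0 1 z \<noteq> 0" "?p 0 0 1 \<noteq> 0" for x z
    by (auto simp: vec_eq_iff forall_3)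
  \<comment> \<open>The line at infinity is spanned by two frame points with fixed images, so affine
    points stay affine.\<close>
  have fin: "\<kappa> (?p 1 x z) $ 1 \<noteq> 0" for x z
    using coll[OF nz(2) nz(3) nz(1), of 0 x z] frame by (auto simp: triple_expand)
  define \<theta> where "\<theta> x = \<kappa> (?p 1 x 0) $ 2 / \<kappa> (?p 1 x 0) $ 1" for x
  define \<theta>' where "\<theta>' z = \<kappa> (?p 1 0 z) $ 3 / \<kappa> (?p 1 0 z) $ 1" for z
  \<comment> \<open>The point \<open>(1, x, z)\<close> is on the line joining
    \<open>(0, 0, 1)\<close> to \<open>(1, x, 0)\<close>; the next claim uses the line joining
    \<open>(0, 1, 0)\<close> to \<open>(1, 0, z)\<close>.\<close>
  have 2: "\<kappa> (?p 1 x z) $ 2 = \<kappa> (?p 1 x z) $ 1 * \<theta> x" for x z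
    using coll[OF nz(3) nz(1) nz(1), of x 0 x z] frame fin[of x 0]
    by (simp add: triple_expand \<theta>_def field_simps)
  have 3: "\<kappa> (?p 1 x z) $ 3 = \<kappa> (?p 1 x z) $ 1 * \<theta>' z" for x z
    using coll[OF nz(2) nz(1) nz(1), of 0 0 z x z] frame fin[of 0 z]
    by (simp add: triple_expand \<theta>'_def field_simps)
  \<comment> \<open>The diagonal through \<open>(1, 0, 0)\<close> and \<open>(1, 1, 1)\<close> is
    preserved, which identifies the two coordinate maps.\<close>
  have \<theta>': "\<theta>' x = \<theta> x" for x
    using coll[OF nz(1) nz(1) nz(1), of 0 0 1 1 x x] frame fin[of x x] 2[of x x] 3[of x x]
    by (simp add: triple_expand)
  have \<kappa>1: "\<kappa> (?p 1 x z) = \<kappa> (?p 1 x z) $ 1 *s ?p 1 (\<theta> x) (\<theta> z)" for x z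
    using 2[of x z] 3[of x z] by (simp add: vec_eq_iff forall_3 \<theta>')
  have \<theta>1: "\<theta> 1 = 1" using 2[of 1 1] frame by simp
  have \<theta>0: "\<theta> 0 = 0" using frame by (simp add: \<theta>_def)
  \<comment> \<open>The point \<open>(0, 1, m)\<close> is where the line joining
    \<open>(1, 0, 0)\<close> and \<open>(1, 1, m)\<close> meets the line at infinity.\<close>
  have slope: "\<kappa> (?p 0 1 m) $ 1 = 0" "\<kappa> (?p 0 1 m) $ 2 \<noteq> 0"
    "\<kappa> (?p 0 1 m) $ 3 = \<kappa> (?p 0 1 m) $ 2 * \<theta> m" for m
  proof -
    show 1: "\<kappa> (?p 0 1 m) $ 1 = 0"
      using coll[OF nz(2) nz(3) nz(2), of 0 m] frame by (simp add: triple_expand)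
    show "\<kappa> (?p 0 1 m) $ 2 \<noteq> 0"
      using coll[OF nz(1) nz(3) nz(2), of 0 0 m] frame by (auto simp: triple_expand)
    show "\<kappa> (?p 0 1 m) $ 3 = \<kappa> (?p 0 1 m) $ 2 * \<theta> m"
      using coll[OF nz(1) nz(1) nz(2), of 0 0 1 m m] frame fin[of 1 m] 2[of 1 m] 3[of 1 m] 1
      by (simp add: triple_expand \<theta>' \<theta>1)
  qed
  have affine: "\<theta> (m * x + b) = \<theta> m * \<theta> x + \<theta> b" for m x b
  proof -
    let ?u = "\<kappa> (?p 1 0 b)" and ?v = "\<kappa> (?p 0 1 m)" and ?w = "\<kappa> (?p 1 x (m * x + b))"
    have "triple ?u ?v ?w = 0"
      using coll[OF nz(1) nz(2) nz(1), of 0 b m x "m * x + b"] by (simp add: triple_expand)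
    moreover have "triple ?u ?v ?w = ?u $ 1 * ?v $ 2 * ?w $ 1 * (\<theta> (m * x + b) - \<theta> m * \<theta> x - \<theta> b)"
      unfolding triple_expand 2 3 \<theta>' slope \<theta>0 by (simp add: algebra_simps)
    ultimately have "\<theta> (m * x + b) - \<theta> m * \<theta> x - \<theta> b = 0" using fin slope(2) by (simp del: diff_eq_eq)
    then show ?thesis by (simp add: algebra_simps)
  qed
  show ?thesis
  proof (rule that)
    show "\<theta> (x + y) = \<theta> x + \<theta> y" for x y using affine[of 1 x y] \<theta>1 by simp
    show "\<theta> (x * y) = \<theta> x * \<theta> y" for x y using affine[of x y 0] \<theta>0 by simp
    show "\<exists>c. c \<noteq> 0 \<and> \<kappa> (?p 1 x z) = c *s ?p 1 (\<theta> x) (\<theta> z)" for x z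
      using \<kappa>1 fin by blast
  qed (rule \<theta>1)
qed

text \<open>The fundamental theorem of projective geometry for the plane: a linear map is chosen
  that agrees with \<kappa> on the standard frame, and its inverse reduces to the normalized
  case.\<close>

lemma collineation_semilinear:
  fixes \<kappa> :: "'k::field ^ 3 \<Rightarrow> 'k ^ 3"
  assumes coll: "\<And>u v w. u \<noteq> 0 \<Longrightarrow> v \<noteq> 0 \<Longrightarrow> w \<noteq> 0 \<Longrightarrow>
      triple (\<kappa> u) (\<kappa> v) (\<kappa> w) = 0 \<longleftrightarrow> triple u v w = 0"
  obtains A :: "'k ^ 3 ^ 3" and \<theta> :: "'k \<Rightarrow> 'k" and a
  where "invertible A" "\<theta> 1 = 1" "\<And>x y. \<theta> (x + y) = \<theta> x + \<theta> y" "\<And>x y. \<theta> (x * y) = \<theta> x * \<theta> y"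
    "\<And>x z. \<exists>c. c \<noteq> 0 \<and> \<kappa> (vector [1, x, z]) = c *s (A *v vector [1, \<theta> x, \<theta> z])"
    "a \<noteq> 0" "\<kappa> (vector [0, 0, 1]) = a *s (A *v vector [0, 0, 1])"
proof -
  let ?p = "\<lambda>x y z. vector [x, y, z] :: 'k ^ 3"
  define g1 g2 g3 g0 where g: "g1 = \<kappa> (?p 1 0 0)" "g2 = \<kappa> (?p 0 1 0)" "g3 = \<kappa> (?p 0 0 1)"
    "g0 = \<kappa> (?p 1 1 1)"
  have nz: "?p 1 0 0 \<noteq> 0" "?p 0 1 0 \<noteq> 0" "?p 0 0 1 \<noteq> 0" "?p 1 1 1 \<noteq> 0"
    by (auto simp: vec_eq_iff forall_3)
  define A0 :: "'k ^ 3 ^ 3" where "A0 = transpose (vector [g1, g2, g3])"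
  have A0: "A0 *v ?p x y z = x *s g1 + y *s g2 + z *s g3" for x y z
    by (simp add: A0_def matrix_vector_mult_def transpose_def vec_eq_iff sum_3 forall_3 mult.commute)
  have "det A0 \<noteq> 0"
    using coll[OF nz(1) nz(2) nz(3)] by (simp add: A0_def det_transpose g triple_expand flip: triple_def)
  then have "invertible A0" by (simp add: invertible_det_nz)
  then have "surj ((*v) A0)" by (simp add: invertible_eq_bij bij_is_surj)
  then obtain d where "A0 *v d = g0" by (metis surj_def)
  moreover obtain d1 d2 d3 where "d = ?p d1 d2 d3"
    using forall_vector_3[of "\<lambda>d. \<exists>d1 d2 d3. d = ?p d1 d2 d3"] by metis
  ultimately have g0: "g0 = d1 *s g1 + d2 *s g2 + d3 *s g3" using A0 by simp
  have det: "triple g1 g2 g3 \<noteq> 0" using coll[OF nz(1) nz(2) nz(3)] by (simp add: g triple_expand)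
  \<comment> \<open>Cramer's rule: no three frame points are collinear, hence all coordinates
    \<open>d1\<close>, \<open>d2\<close>, \<open>d3\<close> of \<open>g0\<close> are
    nonzero.\<close>
  have "triple g0 g2 g3 \<noteq> 0" "triple g0 g1 g3 \<noteq> 0" "triple g0 g1 g2 \<noteq> 0"
    unfolding g using coll nz by (simp_all add: triple_expand)
  moreover have "triple g0 g2 g3 = d1 * triple g1 g2 g3" "triple g0 g1 g3 = - d2 * triple g1 g2 g3"
    "triple g0 g1 g2 = d3 * triple g1 g2 g3"
    unfolding g0 by (simp_all add: triple_expand algebra_simps)
  ultimately have d: "d1 \<noteq> 0" "d2 \<noteq> 0" "d3 \<noteq> 0" by auto
  \<comment> \<open>Scaling the columns by these coordinates makes \<open>A\<close> send
    \<open>(1, 1, 1)\<close> exactly to \<open>g0\<close>.\<close>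
  define A :: "'k ^ 3 ^ 3" where "A = transpose (vector [d1 *s g1, d2 *s g2, d3 *s g3])"
  have A: "A *v ?p x y z = (x * d1) *s g1 + (y * d2) *s g2 + (z * d3) *s g3" for x y z
    by (simp add: A_def matrix_vector_mult_def transpose_def vec_eq_iff sum_3 forall_3 mult_ac)
  have "det A = d1 * d2 * d3 * triple g1 g2 g3"
    unfolding A_def det_transpose by (simp add: det_3 triple_expand algebra_simps)
  then have "invertible A" using d det by (simp add: invertible_det_nz)
  then obtain B where B: "B ** A = mat 1" "A ** B = mat 1" by (auto simp: invertible_def)
  then have BA: "B *v (A *v x) = x" and AB: "A *v (B *v x) = x" for x
    by (simp_all add: matrix_vector_mul_assoc)
  have "invertible B" using B by (auto simp: invertible_def)
  then have "det B \<noteq> 0" by (simp add: invertible_det_nz)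
  define \<kappa>' where "\<kappa>' u = B *v \<kappa> u" for u
  have B_eq: "B *v u = v \<longleftrightarrow> u = A *v v" for u v using BA[of v] AB[of u] by auto
  obtain \<theta> where \<theta>: "\<theta> 1 = 1" "\<And>x y. \<theta> (x + y) = \<theta> x + \<theta> y" "\<And>x y. \<theta> (x * y) = \<theta> x * \<theta> y"
    "\<And>x z. \<exists>c. c \<noteq> 0 \<and> \<kappa>' (?p 1 x z) = c *s ?p 1 (\<theta> x) (\<theta> z)"
  proof (rule collineation_semilinear_normalized[of \<kappa>' "1 / d1" "1 / d2" "1 / d3"])
    show "triple (\<kappa>' u) (\<kappa>' v) (\<kappa>' w) = 0 \<longleftrightarrow> triple u v w = 0"
      if "u \<noteq> 0" "v \<noteq> 0" "w \<noteq> 0" for u v w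
      using coll[OF that] \<open>det B \<noteq> 0\<close> by (simp add: \<kappa>'_def triple_matrix_vector_mult)
    show "\<kappa>' (?p 1 0 0) = ?p (1 / d1) 0 0" "\<kappa>' (?p 0 1 0) = ?p 0 (1 / d2) 0"
      "\<kappa>' (?p 0 0 1) = ?p 0 0 (1 / d3)" "\<kappa>' (?p 1 1 1) = ?p 1 1 1"
      unfolding \<kappa>'_def B_eq A g[symmetric] using d g0 by simp_all
  qed (use d in \<open>auto\<close>)
  show ?thesis
  proof (rule that[of A \<theta> "1 / d3"])
    show "\<kappa> (?p 0 0 1) = (1 / d3) *s (A *v ?p 0 0 1)"
      unfolding A using d by (simp add: g)
    fix x z
    obtain c where c: "c \<noteq> 0" "\<kappa>' (?p 1 x z) = c *s ?p 1 (\<theta> x) (\<theta> z)" using \<theta>(4) by blast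
    then have "\<kappa> (?p 1 x z) = c *s (A *v ?p 1 (\<theta> x) (\<theta> z))"
      unfolding \<kappa>'_def B_eq by (simp add: vec.scale)
    with c show "\<exists>c. c \<noteq> 0 \<and> \<kappa> (?p 1 x z) = c *s (A *v ?p 1 (\<theta> x) (\<theta> z))" by blast
  qed (use \<open>invertible A\<close> \<theta> d in auto)
qed

section \<open>Coordinates for the Andre/Bruck-Bose plane\<close>

lemma proj_points_iff:
  "P \<in> proj_points \<longleftrightarrow> (\<exists>u. u \<noteq> 0 \<and> P = vec.span {u})"
proof
  assume "P \<in> proj_points"
  then have P: "vec.subspace P" "vec.dim P = 1" by (auto simp: proj_subspaces_def)
  obtain B where B: "B \<subseteq> P" "vec.independent B" "vec.span B = P" "card B = 1"
    using vec.basis_subspace_exists[OF P(1)] P(2) by metis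
  obtain u where "B = {u}" using B(4) by (auto simp: card_1_singleton_iff)
  with B show "\<exists>u. u \<noteq> 0 \<and> P = vec.span {u}"
    using vec.dependent_zero[of B] by auto
next
  assume "\<exists>u. u \<noteq> 0 \<and> P = vec.span {u}"
  then show "P \<in> proj_points"
    by (auto simp: proj_subspaces_def vec.dim_insert)
qed

lemma span_singleton_scale:
  assumes "c \<noteq> (0::'a::field)"
  shows "vec.span {c *s u} = vec.span {u :: 'a ^ 'n}"
proof
  show "vec.span {c *s u} \<subseteq> vec.span {u}"
    by (intro vec.span_minimal) (auto intro: vec.span_scale vec.span_base)
  have "u = (1 / c) *s (c *s u)" using assms by (simp only: vec.scale_scale) simp
  then have "u \<in> vec.span {c *s u}" by (metis vec.span_scale vec.span_base singletonI)
  then show "vec.span {u} \<subseteq> vec.span {c *s u}"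
    by (intro vec.span_minimal) auto
qed

lemma span_singleton_subset_iff:
  assumes "vec.subspace W" shows "vec.span {u} \<subseteq> W \<longleftrightarrow> u \<in> W"
proof
  show "vec.span {u} \<subseteq> W \<Longrightarrow> u \<in> W" using vec.span_base[of u "{u}"] by auto
  show "u \<in> W \<Longrightarrow> vec.span {u} \<subseteq> W" using assms by (intro vec.span_minimal) auto
qed

text \<open>Here \<open>b\<close> gives \<Sigma> the structure of a plane over \<open>'k\<close>
  whose one-dimensional subspaces are the spread lines, and \<open>h\<close> plays the role of an
  affine origin.\<close>

locale abb_coordinates =
  fixes \<Sigma> :: "('f::field ^ 5) set" and S :: "('f ^ 5) set set" and \<iota> :: "'f \<Rightarrow> 'k::field"
    and b :: "'k \<Rightarrow> 'k \<Rightarrow> 'f ^ 5" and h :: "'f ^ 5"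
  assumes Sigma: "\<Sigma> \<in> proj_subspaces 3" and spread: "S \<subseteq> proj_lines" and h: "h \<notin> \<Sigma>"
    and iota_1: "\<iota> 1 = 1" and iota_add: "\<iota> (c + d) = \<iota> c + \<iota> d"
    and iota_mult: "\<iota> (c * d) = \<iota> c * \<iota> d"
    and b_add: "b (x + x') (z + z') = b x z + b x' z'"
    and b_scale: "b (\<iota> c * x) (\<iota> c * z) = c *s b x z"
    and b_eq_0: "b x z = 0 \<Longrightarrow> x = 0 \<and> z = 0"
    and Sigma_iff: "u \<in> \<Sigma> \<longleftrightarrow> (\<exists>x z. u = b x z)"
    and S_iff: "l \<in> S \<longleftrightarrow> (\<exists>x z. (x \<noteq> 0 \<or> z \<noteq> 0) \<and> l = {b (k * x) (k * z) | k. True})"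
begin

lemma Sigma_subspace: "vec.subspace \<Sigma>" and Sigma_dim: "vec.dim \<Sigma> = 4"
  using Sigma by (auto simp: proj_subspaces_def)

lemma iota_0 [simp]: "\<iota> 0 = 0"
  using iota_add[of 0 0] by (metis add.right_neutral add_left_cancel)

lemma iota_minus: "\<iota> (- c) = - \<iota> c"
  using iota_add[of c "- c"] by (simp add: eq_neg_iff_add_eq_0 add.commute)

lemma iota_eq_0 [simp]: "\<iota> c = 0 \<longleftrightarrow> c = 0"
proof
  assume 0: "\<iota> c = 0"
  show "c = 0"
  proof (rule ccontr)
    assume "c \<noteq> 0"
    then show False using iota_mult[of c "1 / c"] 0 iota_1 by simp
  qed
qed simp

lemma iota_eq [simp]: "\<iota> c = \<iota> d \<longleftrightarrow> c = d"
  using iota_eq_0[of "c - d"] iota_add[of "c - d" d] by auto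

lemma b_0 [simp]: "b 0 0 = 0"
  using b_add[of 0 0 0 0] by simp

lemma b_minus: "b (- x) (- z) = - b x z"
  using b_add[of x "- x" z "- z"] by (simp add: eq_neg_iff_add_eq_0 add.commute)

lemma b_diff: "b (x - x') (z - z') = b x z - b x' z'"
  using b_add[of x "- x'" z "- z'"] by (simp add: b_minus)

lemma b_eq: "b x z = b x' z' \<longleftrightarrow> x = x' \<and> z = z'"
  using b_eq_0[of "x - x'" "z - z'"] by (auto simp: b_diff)

lemma b_in_Sigma [simp]: "b x z \<in> \<Sigma>"
  using Sigma_iff by blast

lemma decompose: obtains a x z where "u = a *s h + b x z"
proof -
  have dim: "vec.dim \<Sigma> + 1 = CARD(5)" using Sigma_dim by simp
  obtain f where f: "\<And>x y. f (x + y) = f x + f y" "\<And>c x. f (c *s x) = c * f x"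
    "\<And>x. f x = 0 \<longleftrightarrow> x \<in> \<Sigma>" "f h = (1::'f)"
    by (rule hyperplane_functional[OF Sigma_subspace dim h]) blast
  have "f (u + (- f u) *s h) = f u + (- f u) * f h" by (simp only: f(1,2))
  then have "f (u + (- f u) *s h) = 0" unfolding f(4) by simp
  then obtain x z where "u + (- f u) *s h = b x z" unfolding f(3) Sigma_iff by blast
  then have "u = f u *s h + b x z" by (simp add: algebra_simps)
  then show ?thesis by (rule that)
qed

lemma in_Sigma_iff: "a *s h + b x z \<in> \<Sigma> \<longleftrightarrow> a = 0"
proof
  assume "a *s h + b x z \<in> \<Sigma>"
  then have "a *s h \<in> \<Sigma>"
    using vec.subspace_diff[OF Sigma_subspace _ b_in_Sigma[of x z]] by fastforce
  then have "(1 / a) *s (a *s h) \<in> \<Sigma>" by (rule vec.subspace_scale[OF Sigma_subspace])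
  with h show "a = 0" by (cases "a = 0") (simp, simp only: vec.scale_scale, simp)
qed simp

lemma decompose_unique:
  assumes "a *s h + b x z = a' *s h + b x' z'"
  shows "a = a'" "x = x'" "z = z'"
proof -
  have "(a - a') *s h + b (x - x') (z - z') = 0"
    using assms by (simp add: b_diff algebra_simps)
  moreover from this have "a - a' = 0"
    using in_Sigma_iff vec.subspace_0[OF Sigma_subspace] by metis
  ultimately show "a = a'" "x = x'" "z = z'" using b_eq_0[of "x - x'" "z - z'"] by auto
qed

text \<open>The standard model: \<open>(1, x, z)\<close> is the affine point
  \<open>h + b x z\<close>, and \<open>(0, x, z)\<close> is the spread line through
  \<open>b x z\<close>.\<close>

definition abb :: "'k ^ 3 \<Rightarrow> ('f ^ 5) set" where
  "abb u = (if u$1 \<noteq> 0 then vec.span {h + b (u$2 / u$1) (u$3 / u$1)}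
     else {b (k * u$2) (k * u$3) | k. True})"

text \<open>The equation is linear over \<open>'k\<close>, but the first coordinate is restricted to
  the subfield; this makes the set a subspace over \<open>'f\<close>.\<close>

definition line :: "'k ^ 3 \<Rightarrow> ('f ^ 5) set" where
  "line n = {a *s h + b x z | a x z. pairing n (vector [\<iota> a, x, z]) = 0}"

lemma abb_in_abb_points:
  assumes "u \<noteq> 0"
  shows "abb u \<in> abb_points \<Sigma> S"
proof (cases "u $ 1 = 0")
  case True
  with assms have "u $ 2 \<noteq> 0 \<or> u $ 3 \<noteq> 0" by (auto simp: vec_eq_iff forall_3)
  then have "abb u \<in> S" using True unfolding abb_def S_iff by auto
  then show ?thesis by (simp add: abb_points_def)
next
  case False
  let ?h = "h + b (u$2 / u$1) (u$3 / u$1)"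
  have "?h \<notin> \<Sigma>" using in_Sigma_iff[of 1] by simp
  then have "?h \<noteq> 0" "\<not> vec.span {?h} \<subseteq> \<Sigma>"
    using vec.subspace_0[OF Sigma_subspace] span_singleton_subset_iff[OF Sigma_subspace] by auto
  then show ?thesis
    using False unfolding abb_points_def abb_def points_in_def by (auto simp: proj_points_iff)
qed

lemma line_subspace: "vec.subspace (line n)"
proof (rule vec.subspaceI)
  show "0 \<in> line n" unfolding line_def
    by (rule CollectI, rule exI[of _ 0], rule exI[of _ 0], rule exI[of _ 0]) (simp add: pairing_def)
  show "u + v \<in> line n" if uv: "u \<in> line n" "v \<in> line n" for u v
  proof -
    obtain a x z where u: "u = a *s h + b x z" "pairing n (vector [\<iota> a, x, z]) = 0"
      using uv(1) unfolding line_def by blast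
    obtain a' x' z' where v: "v = a' *s h + b x' z'" "pairing n (vector [\<iota> a', x', z']) = 0"
      using uv(2) unfolding line_def by blast
    have "u + v = (a + a') *s h + b (x + x') (z + z')"
      unfolding u v b_add by (simp add: algebra_simps)
    moreover have "pairing n (vector [\<iota> (a + a'), x + x', z + z']) =
        pairing n (vector [\<iota> a, x, z]) + pairing n (vector [\<iota> a', x', z'])"
      unfolding pairing_def iota_add by (simp add: algebra_simps)
    ultimately show ?thesis unfolding line_def using u(2) v(2)
      by (intro CollectI exI conjI) simp_all
  qed
  show "c *s u \<in> line n" if u: "u \<in> line n" for c u
  proof -
    obtain a x z where u: "u = a *s h + b x z" "pairing n (vector [\<iota> a, x, z]) = 0"
      using u unfolding line_def by blast
    have "c *s u = (c * a) *s h + b (\<iota> c * x) (\<iota> c * z)"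
      unfolding u b_scale by (simp only: vec.scale_right_distrib vec.scale_scale)
    moreover have "pairing n (vector [\<iota> (c * a), \<iota> c * x, \<iota> c * z]) = \<iota> c * pairing n (vector [\<iota> a, x, z])"
      unfolding pairing_def iota_mult by (simp add: algebra_simps)
    ultimately show ?thesis unfolding line_def using u(2)
      by (intro CollectI exI conjI) simp_all
  qed
qed

lemma in_line_iff: "a *s h + b x z \<in> line n \<longleftrightarrow> pairing n (vector [\<iota> a, x, z]) = 0"
proof
  assume "a *s h + b x z \<in> line n"
  then obtain a' x' z' where "a *s h + b x z = a' *s h + b x' z'" "pairing n (vector [\<iota> a', x', z']) = 0"
    unfolding line_def by blast
  then show "pairing n (vector [\<iota> a, x, z]) = 0" using decompose_unique by metis
qed (auto simp: line_def)

lemma b_in_line_iff: "b x z \<in> line n \<longleftrightarrow> n$2 * x + n$3 * z = 0"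
  using in_line_iff[of 0 x z n] by (simp add: pairing_def)

lemma abb_subset_line_iff:
  assumes "u \<noteq> 0"
  shows "abb u \<subseteq> line n \<longleftrightarrow> pairing n u = 0"
proof (cases "u $ 1 = 0")
  case True
  have "b (k * u$2) (k * u$3) \<in> line n \<longleftrightarrow> k * pairing n u = 0" for k
    unfolding b_in_line_iff using True by (simp add: pairing_def algebra_simps)
  then have "abb u \<subseteq> line n \<longleftrightarrow> (\<forall>k. k * pairing n u = 0)"
    using True unfolding abb_def by auto
  also have "\<dots> \<longleftrightarrow> pairing n u = 0" by (auto dest: spec[of _ 1])
  finally show ?thesis .
next
  case False
  then have "abb u \<subseteq> line n \<longleftrightarrow> 1 *s h + b (u$2 / u$1) (u$3 / u$1) \<in> line n"
    by (simp add: abb_def span_singleton_subset_iff line_subspace)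
  also have "\<dots> \<longleftrightarrow> pairing n u / u$1 = 0"
    unfolding in_line_iff using False by (simp add: pairing_def iota_1 add_divide_distrib)
  finally show ?thesis using False by simp
qed

lemma line_in_abb_lines:
  assumes "n \<noteq> 0"
  shows "line n \<in> abb_lines \<Sigma> S"
proof (cases "n$2 = 0 \<and> n$3 = 0")
  case True
  then have "n$1 \<noteq> 0" using assms by (auto simp: vec_eq_iff forall_3)
  then have "line n = \<Sigma>"
    using True unfolding line_def set_eq_iff Sigma_iff by (auto simp: pairing_def)
  then show ?thesis by (simp add: abb_lines_def)
next
  case False
  \<comment> \<open>One affine point of the line; together with the spread line at infinity it spans
    a plane.\<close>
  obtain x0 z0 where xz: "n$1 + n$2 * x0 + n$3 * z0 = 0"
  proof (cases "n$2 = 0")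
    case True
    with False show ?thesis by (intro that[of 0 "- n$1 / n$3"]) auto
  next
    case False
    then show ?thesis by (intro that[of "- n$1 / n$2" 0]) auto
  qed
  let ?h = "1 *s h + b x0 z0"
  have h1: "?h \<in> line n" using xz unfolding in_line_iff by (simp add: pairing_def iota_1)
  have h2: "?h \<notin> \<Sigma>" using in_Sigma_iff[of 1] by simp
  have S: "line n \<inter> \<Sigma> \<in> S"
  proof -
    \<comment> \<open>The solutions of one equation in two unknowns are the multiples of
      \<open>(n$3, - n$2)\<close>, hence form a spread line.\<close>
    have "n$2 * x + n$3 * z = 0 \<longleftrightarrow> (\<exists>k. x = k * n$3 \<and> z = k * (- n$2))" for x z
    proof
      assume 0: "n$2 * x + n$3 * z = 0"
      show "\<exists>k. x = k * n$3 \<and> z = k * (- n$2)"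
      proof (cases "n$2 = 0")
        case True
        with False 0 show ?thesis by (intro exI[of _ "x / n$3"]) auto
      next
        case n2: False
        have "x = - (n$3 * z / n$2)" using 0 n2 by (simp add: field_simps eq_neg_iff_add_eq_0)
        with n2 show ?thesis by (intro exI[of _ "- z / n$2"]) auto
      qed
    qed auto
    then have b: "b x z \<in> line n \<longleftrightarrow> (\<exists>k. x = k * n$3 \<and> z = k * (- n$2))" for x z
      unfolding b_in_line_iff .
    have "line n \<inter> \<Sigma> = {b (k * n$3) (k * (- n$2)) | k. True}"
    proof (intro equalityI subsetI)
      fix u assume "u \<in> line n \<inter> \<Sigma>"
      then obtain x z where "u = b x z" "b x z \<in> line n" unfolding Int_iff Sigma_iff by blast
      then show "u \<in> {b (k * n$3) (k * (- n$2)) | k. True}" unfolding b by blast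
    next
      fix u assume "u \<in> {b (k * n$3) (k * (- n$2)) | k. True}"
      then obtain k where "u = b (k * n$3) (k * (- n$2))" by blast
      moreover have "b (k * n$3) (k * (- n$2)) \<in> line n" unfolding b by blast
      ultimately show "u \<in> line n \<inter> \<Sigma>" by simp
    qed
    then show ?thesis unfolding S_iff using False by (intro exI[of _ "n$3"] exI[of _ "- n$2"]) auto
  qed
  then have L: "vec.subspace (line n \<inter> \<Sigma>)" "vec.dim (line n \<inter> \<Sigma>) = 2"
    using spread by (auto simp: proj_subspaces_def)
  have "vec.dim (line n) = vec.dim (line n \<inter> \<Sigma>) + 1"
  proof (rule vec_dim_complement[OF L(1) line_subspace _ h1])
    fix u assume u: "u \<in> line n"
    obtain a x z where "u = a *s h + b x z" by (rule decompose)
    then have "u - a *s ?h = b (x - \<iota> a * x0) (z - \<iota> a * z0)"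
      by (simp add: b_diff b_scale vec.scale_right_distrib)
    moreover have "u - a *s ?h \<in> line n"
      using vec.subspace_diff[OF line_subspace u vec.subspace_scale[OF line_subspace h1]] .
    ultimately show "\<exists>a. u - a *s ?h \<in> line n \<inter> \<Sigma>" by (intro exI[of _ a]) simp
  qed (use h2 in auto)
  then show ?thesis using L(2) S h1 h2 line_subspace by (auto simp: abb_lines_def proj_subspaces_def)
qed

text \<open>An inclusion suffices, because collinearity asks only for some line containing three
  given points.\<close>

lemma abb_line_subset_line:
  assumes W: "W \<in> abb_lines \<Sigma> S"
  obtains n where "n \<noteq> 0" "W \<subseteq> line n"
proof (cases "W = \<Sigma>")
  case True
  then have "W \<subseteq> line (vector [1, 0, 0])"
    by (auto simp: Sigma_iff b_in_line_iff)
  then show ?thesis by (rule that[rotated]) (simp add: vec_eq_iff forall_3)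
next
  case False
  then have "vec.subspace W" "\<not> W \<subseteq> \<Sigma>" "W \<inter> \<Sigma> \<in> S"
    using W by (auto simp: abb_lines_def proj_subspaces_def)
  then obtain x z u where xz: "x \<noteq> 0 \<or> z \<noteq> 0" "W \<inter> \<Sigma> = {b (k * x) (k * z) | k. True}"
    and u: "u \<in> W" "u \<notin> \<Sigma>" unfolding S_iff by blast
  obtain a x1 z1 where u': "u = a *s h + b x1 z1" by (rule decompose)
  then have a: "a \<noteq> 0" using u in_Sigma_iff by blast
  \<comment> \<open>Up to sign, the cross product of \<open>(\<iota> a, x1, z1)\<close> and
    \<open>(0, x, z)\<close>, the coordinates of an affine vector and of a direction in
    \<open>W\<close>.\<close>
  define n :: "'k ^ 3" where "n = vector [x * z1 - z * x1, \<iota> a * z, - \<iota> a * x]"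
  show ?thesis
  proof (rule that[of n])
    show "n \<noteq> 0" using xz(1) a by (auto simp: n_def vec_eq_iff forall_3)
    show "W \<subseteq> line n"
    proof
      fix w assume w: "w \<in> W"
      obtain c x2 z2 where w': "w = c *s h + b x2 z2" by (rule decompose)
      let ?c = "c / a"
      have "w - ?c *s u = b (x2 - \<iota> ?c * x1) (z2 - \<iota> ?c * z1)"
        unfolding w' u' using a by (simp add: b_diff b_scale vec.scale_right_distrib)
      moreover have "w - ?c *s u \<in> W"
        using vec.subspace_diff[OF \<open>vec.subspace W\<close> w vec.subspace_scale[OF \<open>vec.subspace W\<close> u(1)]] .
      ultimately have "b (x2 - \<iota> ?c * x1) (z2 - \<iota> ?c * z1) \<in> W \<inter> \<Sigma>" by simp
      then obtain k where k: "x2 - \<iota> ?c * x1 = k * x" "z2 - \<iota> ?c * z1 = k * z"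
        unfolding xz(2) by (auto simp: b_eq)
      have c: "\<iota> c = \<iota> ?c * \<iota> a" using a by (simp flip: iota_mult)
      have "x2 = \<iota> ?c * x1 + k * x" "z2 = \<iota> ?c * z1 + k * z" using k by (simp_all add: algebra_simps)
      then show "w \<in> line n"
        unfolding w' in_line_iff by (simp add: n_def pairing_def c algebra_simps)
    qed
  qed
qed

lemma triple_eq_0_iff_abb_line:
  assumes "u \<noteq> 0" "v \<noteq> 0" "w \<noteq> 0"
  shows "triple u v w = 0 \<longleftrightarrow> (\<exists>W \<in> abb_lines \<Sigma> S. abb u \<subseteq> W \<and> abb v \<subseteq> W \<and> abb w \<subseteq> W)"
proof -
  have "(\<exists>W \<in> abb_lines \<Sigma> S. abb u \<subseteq> W \<and> abb v \<subseteq> W \<and> abb w \<subseteq> W) \<longleftrightarrow>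
      (\<exists>n. n \<noteq> 0 \<and> abb u \<subseteq> line n \<and> abb v \<subseteq> line n \<and> abb w \<subseteq> line n)"
  proof
    assume "\<exists>W \<in> abb_lines \<Sigma> S. abb u \<subseteq> W \<and> abb v \<subseteq> W \<and> abb w \<subseteq> W"
    then obtain W where W: "W \<in> abb_lines \<Sigma> S" "abb u \<subseteq> W" "abb v \<subseteq> W" "abb w \<subseteq> W" by (elim bexE conjE)
    obtain n where "n \<noteq> 0" "W \<subseteq> line n" using abb_line_subset_line[OF W(1)] .
    with W show "\<exists>n. n \<noteq> 0 \<and> abb u \<subseteq> line n \<and> abb v \<subseteq> line n \<and> abb w \<subseteq> line n"
      by (intro exI[of _ n] conjI order_trans[OF _ \<open>W \<subseteq> line n\<close>])
  next
    assume "\<exists>n. n \<noteq> 0 \<and> abb u \<subseteq> line n \<and> abb v \<subseteq> line n \<and> abb w \<subseteq> line n"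
    then obtain n where "n \<noteq> 0" "abb u \<subseteq> line n" "abb v \<subseteq> line n" "abb w \<subseteq> line n" by (elim exE conjE)
    then show "\<exists>W \<in> abb_lines \<Sigma> S. abb u \<subseteq> W \<and> abb v \<subseteq> W \<and> abb w \<subseteq> W"
      by (intro bexI[OF _ line_in_abb_lines] conjI)
  qed
  then show ?thesis
    unfolding triple_eq_0_iff_pairing abb_subset_line_iff[OF assms(1)]
      abb_subset_line_iff[OF assms(2)] abb_subset_line_iff[OF assms(3)] by (simp only:)
qed

text \<open>Composing \<phi> with the coordinate map \<open>abb\<close> gives a map of the
  Desarguesian plane that preserves and reflects collinearity, so the fundamental theorem
  applies.\<close>

lemma incidence_iso_semilinear:
  assumes "incidence_iso (abb_points \<Sigma> S) (abb_lines \<Sigma> S) (proj_points :: ('k ^ 3) set set) proj_lines \<phi>"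
  obtains A :: "'k ^ 3 ^ 3" and \<theta> :: "'k \<Rightarrow> 'k"
  where "invertible A" "\<theta> 1 = 1" "\<And>x y. \<theta> (x + y) = \<theta> x + \<theta> y" "\<And>x y. \<theta> (x * y) = \<theta> x * \<theta> y"
    "\<And>x z. \<phi> (abb (vector [1, x, z])) = vec.span {A *v vector [1, \<theta> x, \<theta> z]}"
    "\<phi> (abb (vector [0, 0, 1])) = vec.span {A *v vector [0, 0, 1]}"
proof -
  obtain \<psi> where \<phi>: "bij_betw \<phi> (abb_points \<Sigma> S) (proj_points :: ('k ^ 3) set set)"
    and \<psi>: "bij_betw \<psi> (abb_lines \<Sigma> S) (proj_lines :: ('k ^ 3) set set)"
    and inc': "\<forall>P \<in> abb_points \<Sigma> S. \<forall>l \<in> abb_lines \<Sigma> S. \<phi> P \<subseteq> \<psi> l \<longleftrightarrow> P \<subseteq> l"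
    using assms unfolding incidence_iso_def by (elim conjE exE)
  have inc: "\<phi> P \<subseteq> \<psi> l \<longleftrightarrow> P \<subseteq> l" if "P \<in> abb_points \<Sigma> S" "l \<in> abb_lines \<Sigma> S" for P l
    by (rule inc'[rule_format, OF that])
  \<comment> \<open>A spanning vector is picked for each image point; its scale is uncontrolled,
    which is harmless once spans are taken again.\<close>
  define \<kappa> where "\<kappa> u = (SOME k. k \<noteq> 0 \<and> \<phi> (abb u) = vec.span {k})" for u
  have \<kappa>: "\<phi> (abb u) = vec.span {\<kappa> u}" if "u \<noteq> 0" for u
  proof -
    have "\<exists>k. k \<noteq> 0 \<and> \<phi> (abb u) = vec.span {k}"
      using bij_betw_apply[OF \<phi> abb_in_abb_points[OF that]] by (simp only: proj_points_iff)
    from someI_ex[OF this] show ?thesis unfolding \<kappa>_def by (rule conjunct2)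
  qed
  have coll: "triple (\<kappa> u) (\<kappa> v) (\<kappa> w) = 0 \<longleftrightarrow> triple u v w = 0"
    if nz: "u \<noteq> 0" "v \<noteq> 0" "w \<noteq> 0" for u v w
  proof -
    have in_\<psi>: "\<kappa> u \<in> \<psi> l \<longleftrightarrow> abb u \<subseteq> l" if "u \<noteq> 0" "l \<in> abb_lines \<Sigma> S" for u l
    proof -
      have "vec.subspace (\<psi> l)"
        using bij_betw_apply[OF \<psi> that(2)] by (simp add: proj_subspaces_def)
      then have "\<kappa> u \<in> \<psi> l \<longleftrightarrow> \<phi> (abb u) \<subseteq> \<psi> l"
        unfolding \<kappa>[OF that(1)] by (simp only: span_singleton_subset_iff)
      then show ?thesis using inc[OF abb_in_abb_points[OF that(1)] that(2)] by simp
    qed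
    have "triple (\<kappa> u) (\<kappa> v) (\<kappa> w) = 0 \<longleftrightarrow> (\<exists>l \<in> \<psi> ` abb_lines \<Sigma> S. \<kappa> u \<in> l \<and> \<kappa> v \<in> l \<and> \<kappa> w \<in> l)"
      unfolding triple_eq_0_iff_line bij_betw_imp_surj_on[OF \<psi>] ..
    also have "\<dots> \<longleftrightarrow> triple u v w = 0"
      unfolding triple_eq_0_iff_abb_line[OF nz] bex_simps
      by (rule bex_cong[OF refl]) (simp only: in_\<psi>[OF nz(1)] in_\<psi>[OF nz(2)] in_\<psi>[OF nz(3)])
    finally show ?thesis .
  qed
  have nz: "vector [1, x, z] \<noteq> (0 :: 'k ^ 3)" "vector [0, 0, 1] \<noteq> (0 :: 'k ^ 3)" for x z
    by (auto simp: vec_eq_iff forall_3)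
  show ?thesis
  proof (rule collineation_semilinear[of \<kappa>], erule (2) coll)
    fix A :: "'k ^ 3 ^ 3" and \<theta> a
    assume A: "invertible A" "\<theta> 1 = 1" "\<And>x y. \<theta> (x + y) = \<theta> x + \<theta> y"
      "\<And>x y. \<theta> (x * y) = \<theta> x * \<theta> y"
      "\<And>x z. \<exists>c. c \<noteq> 0 \<and> \<kappa> (vector [1, x, z]) = c *s (A *v vector [1, \<theta> x, \<theta> z])"
      "a \<noteq> 0" "\<kappa> (vector [0, 0, 1]) = a *s (A *v vector [0, 0, 1])"
    show thesis
    proof (rule that[OF A(1-4)])
      fix x z
      obtain c where "c \<noteq> 0" "\<kappa> (vector [1, x, z]) = c *s (A *v vector [1, \<theta> x, \<theta> z])" using A(5) by blast
      then show "\<phi> (abb (vector [1, x, z])) = vec.span {A *v vector [1, \<theta> x, \<theta> z]}"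
        unfolding \<kappa>[OF nz(1)] by (simp only: span_singleton_scale not_False_eq_True)
      show "\<phi> (abb (vector [0, 0, 1])) = vec.span {A *v vector [0, 0, 1]}"
        unfolding \<kappa>[OF nz(2)] A(7) using A(6) by (rule span_singleton_scale)
    qed
  qed
qed

end

section \<open>Tits ovoids and cones\<close>

lemma linear_vec_iff:
  "Vector_Spaces.linear (*s) (*s) (T :: 'a::field ^ 'n \<Rightarrow> 'a ^ 'm) \<longleftrightarrow>
    (\<forall>x y. T (x + y) = T x + T y) \<and> (\<forall>c x. T (c *s x) = c *s T x)"
  by (simp add: Vector_Spaces.linear_iff vec.vector_space_axioms)

text \<open>This excludes three independent vectors from a spread line when the cone is cut with
  \<Sigma>.\<close>

lemma dim_2_dependent:
  fixes l :: "('a::field ^ 'n) set"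
  assumes l: "vec.subspace l" "vec.dim l = 2" and u: "u \<in> l" and v: "v \<in> l" and w: "w \<in> l"
  obtains x y z where "x \<noteq> 0 \<or> y \<noteq> 0 \<or> z \<noteq> 0" "x *s u + y *s v + z *s w = 0"
proof (cases "w = 0 \<or> v \<in> vec.span {w}")
  case True
  then show ?thesis
  proof
    assume "w = 0"
    then show ?thesis by (intro that[of 0 0 1]) simp_all
  next
    assume "v \<in> vec.span {w}"
    then obtain k where "v = k *s w" by (auto simp: vec.span_singleton)
    then show ?thesis by (intro that[of 0 1 "- k"]) simp_all
  qed
next
  case False
  then have "vec.dim {v, w} = 2"
    by (simp add: vec.dim_insert)
  then have "vec.span {v, w} = vec.span l"
    using vec.dim_eq_span[of "{v, w}" l] l(2) v w by simp
  then have "u \<in> vec.span {v, w}" using u by (simp add: vec.span_base)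
  then obtain k where "u - k *s v \<in> vec.span {w}" by (auto simp: vec.span_breakdown_eq[of u])
  then obtain m where "u - k *s v = m *s w" by (auto simp: vec.span_singleton)
  then have "u = k *s v + m *s w" by (simp add: algebra_simps)
  then show ?thesis by (intro that[of 1 "- k" "- m"]) simp_all
qed

lemma vector_4 [simp]:
  "(vector [x, y, z, w] :: 'a::zero ^ 4) $ 1 = x" "(vector [x, y, z, w] :: 'a ^ 4) $ 2 = y"
  "(vector [x, y, z, w] :: 'a ^ 4) $ 3 = z" "(vector [x, y, z, w] :: 'a ^ 4) $ 4 = w"
  unfolding vector_def by simp_all

definition ovoid_vectors :: "nat \<Rightarrow> ('a::field ^ 4) set" where
  "ovoid_vectors n = insert (vector [0, 0, 0, 1]) {vector [1, s, t, tits_poly n s t] | s t. True}"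

lemma standard_tits_ovoid_eq: "standard_tits_ovoid n = (\<lambda>c. vec.span {c}) ` ovoid_vectors n"
  unfolding standard_tits_ovoid_def ovoid_vectors_def tits_poly_def by auto

lemma ovoid_vectors_infinity: "vector [0, 0, 0, 1] \<in> ovoid_vectors n"
  and ovoid_vectors_affine: "vector [1, s, t, tits_poly n s t] \<in> ovoid_vectors n"
  unfolding ovoid_vectors_def by blast+

lemma ovoid_vectors_cases:
  assumes "c \<in> ovoid_vectors n"
  obtains "c = vector [0, 0, 0, 1]" | s t where "c = vector [1, s, t, tits_poly n s t]"
  using assms unfolding ovoid_vectors_def by blast

lemma linear_image_span_singleton:
  assumes "Vector_Spaces.linear (*s) (*s) (T :: 'a::field ^ 'n \<Rightarrow> 'a ^ 'm)"
  shows "T ` vec.span {c} = vec.span {T c}"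
  using assms unfolding linear_vec_iff vec.span_singleton by (simp add: image_image)

text \<open>
  The swap \<open>(a, b, c, d) \<mapsto> (d, c, b, a)\<close> of the coordinates preserves the
  ovoid; combined with the translations it moves the point at infinity to any other point.
\<close>

lemma (in suzuki_field) tits_ovoid_transitive:
  assumes F0: "F0 = (UNIV :: 'k set)" and fin: "finite (UNIV :: 'k set)"
    and c: "c \<in> ovoid_vectors \<sigma>"
  obtains G :: "'k ^ 4 \<Rightarrow> 'k ^ 4" where "Vector_Spaces.linear (*s) (*s) G" "bij G"
    "G (vector [0, 0, 0, 1]) = c"
    "(\<lambda>P. G ` P) ` standard_tits_ovoid \<sigma> = standard_tits_ovoid \<sigma>"
  using c
proof (cases rule: ovoid_vectors_cases)
  case 1
  then show ?thesis
    by (intro that[of "\<lambda>x. x"]) (auto simp: linear_vec_iff bij_def)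
next
  case (2 a b)
  define A where "A = a ^ \<sigma>"
  \<comment> \<open>The swap followed by the translation with parameters \<open>a\<close> and
    \<open>b\<close>, whose last row comes from \<open>tits_poly_substitution\<close> with
    \<open>l = 1\<close>.\<close>
  define G :: "'k ^ 4 \<Rightarrow> 'k ^ 4" where
    "G x = vector [x$4, x$3 + a * x$4, x$2 + A * x$3 + b * x$4,
       x$1 + (b + a * A) * x$3 + a * x$2 + tits_poly \<sigma> a b * x$4]" for x
  have lin: "Vector_Spaces.linear (*s) (*s) G"
    unfolding linear_vec_iff by (simp add: G_def vec_eq_iff forall_4 algebra_simps)
  have inj: "inj G"
  proof (rule injI)
    fix x y assume "G x = G y"
    then show "x = y" by (auto simp: G_def vec_eq_iff forall_4)
  qed
  have OV: "\<exists>d\<in>ovoid_vectors \<sigma>. \<exists>k. k \<noteq> 0 \<and> G d' = k *s d" if "d' \<in> ovoid_vectors \<sigma>" for d'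
    using that
  proof (cases rule: ovoid_vectors_cases)
    case 1
    then have "G d' = 1 *s vector [1, a, b, tits_poly \<sigma> a b]"
      by (simp add: G_def)
    then show ?thesis
      by (intro bexI[OF _ ovoid_vectors_affine[of a b]] exI[of _ 1] conjI) simp_all
  next
    case (2 s t)
    let ?f = "tits_poly \<sigma> s t"
    show ?thesis
    proof (cases "?f = 0")
      case True
      then have "s = 0" "t = 0" using tits_poly_eq_0_iff[of s t] F0 by auto
      then have "G d' = 1 *s vector [0, 0, 0, 1]"
        using 2 True by (simp add: G_def)
      then show ?thesis
        by (intro bexI[OF _ ovoid_vectors_infinity] exI[of _ 1] conjI) simp_all
    next
      case False
      \<comment> \<open>The affine parameters after the swap; the translation is then applied to
        them, and \<open>?f\<close> is the scale factor of the image.\<close>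
      let ?s = "t / ?f" and ?t = "s / ?f"
      have "tits_poly \<sigma> (1 * ?s + a) (1 * 1 ^ \<sigma> * ?t + a ^ \<sigma> * 1 * ?s + b) =
          1 * 1 * 1 ^ \<sigma> * tits_poly \<sigma> ?s ?t + tits_poly \<sigma> a b + (b * 1 + a * a ^ \<sigma> * 1) * ?s + a * 1 * 1 ^ \<sigma> * ?t"
        by (rule tits_poly_substitution) (simp_all add: F0)
      then have key: "tits_poly \<sigma> (?s + a) (?t + A * ?s + b) = 1 / ?f + tits_poly \<sigma> a b + (b + a * A) * ?s + a * ?t"
        using tits_poly_swap[OF _ _ False] F0 by (simp add: A_def)
      have f: "?f * tits_poly \<sigma> (?s + a) (?t + A * ?s + b) = 1 + ?f * tits_poly \<sigma> a b + (b + a * A) * t + a * s"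
        unfolding key using False by (simp add: field_simps)
      define u v where uv: "u = ?s + a" "v = ?t + A * ?s + b"
      have "?f * u = t + a * ?f" "?f * v = s + A * t + b * ?f"
        using False by (simp_all add: uv field_simps)
      then have "G d' = ?f *s vector [1, u, v, tits_poly \<sigma> u v]"
        using f[folded uv] 2 by (simp add: G_def vec_eq_iff forall_4 mult.commute add_ac)
      with False show ?thesis
        by (intro bexI[OF _ ovoid_vectors_affine[of u v]] exI[of _ ?f] conjI)
    qed
  qed
  have "(\<lambda>P. G ` P) ` standard_tits_ovoid \<sigma> \<subseteq> standard_tits_ovoid \<sigma>"
  proof
    fix Q assume "Q \<in> (\<lambda>P. G ` P) ` standard_tits_ovoid \<sigma>"
    then obtain d' where d': "d' \<in> ovoid_vectors \<sigma>" "Q = vec.span {G d'}"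
      unfolding standard_tits_ovoid_eq by (auto simp: linear_image_span_singleton[OF lin])
    obtain d k where "d \<in> ovoid_vectors \<sigma>" "k \<noteq> 0" "G d' = k *s d" using OV[OF d'(1)] by blast
    then show "Q \<in> standard_tits_ovoid \<sigma>"
      unfolding standard_tits_ovoid_eq d'(2) by (simp add: span_singleton_scale)
  qed
  moreover have "inj_on (\<lambda>P. G ` P) (standard_tits_ovoid \<sigma>)"
    using inj by (auto intro!: inj_onI simp: inj_image_eq_iff)
  moreover have "finite (standard_tits_ovoid \<sigma> :: ('k ^ 4) set set)"
  proof -
    have "finite (range (\<lambda>(s, t). vector [1, s, t, tits_poly \<sigma> s t] :: 'k ^ 4))"
      using fin by (intro finite_imageI) (simp add: finite_Prod_UNIV)
    moreover have "{vector [1, s, t, tits_poly \<sigma> s t] :: 'k ^ 4 | s t. True} = range (\<lambda>(s, t). vector [1, s, t, tits_poly \<sigma> s t])"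
      by auto
    ultimately show ?thesis unfolding standard_tits_ovoid_eq ovoid_vectors_def by simp
  qed
  \<comment> \<open>An injective map of a finite set into itself is onto, so the inclusion is an
    equality.\<close>
  ultimately have "(\<lambda>P. G ` P) ` standard_tits_ovoid \<sigma> = standard_tits_ovoid \<sigma>"
    by (metis endo_inj_surj)
  moreover have "bij G"
    using vec.linear_inj_imp_surj[OF lin inj] inj by (simp add: bij_def)
  moreover have "G (vector [0, 0, 0, 1]) = c"
    using 2 by (simp add: G_def)
  ultimately show ?thesis using lin by (intro that)
qed

section \<open>Sections of a Tits cone by the hyperplane at infinity\<close>

lemma span_singleton_in_points_in:
  assumes "vec.subspace W" "u \<noteq> 0"
  shows "vec.span {u} \<in> points_in W \<longleftrightarrow> u \<in> W"
proof -
  have "vec.span {u} \<in> proj_points" using assms(2) unfolding proj_points_iff by blast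
  then show ?thesis unfolding points_in_def by (simp add: span_singleton_subset_iff[OF assms(1)])
qed

lemma span_singleton_in_cone_iff:
  assumes T: "Vector_Spaces.linear (*s) (*s) T" and u: "u \<noteq> 0"
  shows "vec.span {u} \<in> cone (vec.span {v}) ((\<lambda>P. T ` P) ` standard_tits_ovoid n) \<longleftrightarrow>
    (\<exists>c\<in>ovoid_vectors n. \<exists>k r. u = k *s T c + r *s v)"
proof -
  have "u \<in> vec.span (vec.span {v} \<union> vec.span {T c}) \<longleftrightarrow> (\<exists>k r. u = k *s T c + r *s v)" for c
  proof -
    have "u \<in> vec.span (vec.span {v} \<union> vec.span {T c}) \<longleftrightarrow>
        (\<exists>x y. u = x + y \<and> x \<in> vec.span {v} \<and> y \<in> vec.span {T c})"
      unfolding vec.span_Un vec.span_span by blast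
    then show ?thesis unfolding vec.span_singleton by (auto simp: add.commute)
  qed
  then show ?thesis
    unfolding cone_def standard_tits_ovoid_eq
    by (simp add: image_image linear_image_span_singleton[OF T] span_singleton_in_points_in[OF vec.subspace_span u])
qed

lemma linear_vec_4:
  assumes "Vector_Spaces.linear (*s) (*s) (T :: 'a::field ^ 4 \<Rightarrow> 'a ^ 'n)"
  shows "T c = c$1 *s T (vector [1, 0, 0, 0]) + c$2 *s T (vector [0, 1, 0, 0])
    + c$3 *s T (vector [0, 0, 1, 0]) + c$4 *s T (vector [0, 0, 0, 1])"
proof -
  have "c = c$1 *s vector [1, 0, 0, 0] + c$2 *s vector [0, 1, 0, 0]
    + c$3 *s vector [0, 0, 1, 0] + c$4 *s vector [0, 0, 0, 1]"
    by (simp add: vec_eq_iff forall_4)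
  then have "T c = T (c$1 *s vector [1, 0, 0, 0] + c$2 *s vector [0, 1, 0, 0]
    + c$3 *s vector [0, 0, 1, 0] + c$4 *s vector [0, 0, 0, 1])" by (rule arg_cong)
  moreover have "T (x + y) = T x + T y" "T (a *s x) = a *s T x" for x y a
    using assms unfolding linear_vec_iff by blast+
  ultimately show ?thesis by (simp only:)
qed

text \<open>
  The vertex lies on \<open>\<Sigma>\<close>: otherwise \<open>\<Sigma>\<close> would cut the cone in a
  copy of the ovoid, which contains three non-collinear points.
\<close>

lemma cone_vertex_in_line:
  fixes \<Sigma> l :: "('f::field ^ 5) set" and v :: "'f ^ 5"
  assumes \<Sigma>: "vec.subspace \<Sigma>" "vec.dim \<Sigma> = 4"
    and l: "vec.subspace l" "vec.dim l = 2"
    and T: "Vector_Spaces.linear (*s) (*s) T" and ind: "\<And>c r. T c + r *s v = 0 \<Longrightarrow> c = 0 \<and> r = 0"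
    and in_l: "\<And>c k r. c \<in> ovoid_vectors n \<Longrightarrow> k *s T c + r *s v \<in> \<Sigma> \<Longrightarrow> k *s T c + r *s v \<in> l"
  shows "v \<in> \<Sigma>"
proof (rule ccontr)
  assume "v \<notin> \<Sigma>"
  have add: "T (x + y) = T x + T y" and scale: "T (a *s x) = a *s T x" for x y a
    using T unfolding linear_vec_iff by blast+
  have dim: "vec.dim \<Sigma> + 1 = CARD(5)" using \<Sigma>(2) by simp
  obtain f where f: "\<And>x y. f (x + y) = f x + f y" "\<And>c x. f (c *s x) = c * f x"
    "\<And>x. f x = 0 \<longleftrightarrow> x \<in> \<Sigma>" "f v = (1::'f)"
    by (rule hyperplane_functional[OF \<Sigma>(1) dim \<open>v \<notin> \<Sigma>\<close>]) blast
  \<comment> \<open>The projection of \<open>T c\<close> from the vertex into \<Sigma>; it stays on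
    the generator through \<open>T c\<close>.\<close>
  define w where "w c = 1 *s T c + (- f (T c)) *s v" for c
  have w: "w c \<in> l" if "c \<in> ovoid_vectors n" for c
  proof -
    have "f (w c) = 1 * f (T c) + (- f (T c)) * f v"
      unfolding w_def by (simp only: f(1,2))
    then have "w c \<in> \<Sigma>" unfolding f(3)[symmetric] f(4) by simp
    then show ?thesis using in_l[OF that] unfolding w_def by blast
  qed
  define c1 c2 c3 :: "'f ^ 4" where c: "c1 = vector [0, 0, 0, 1]" "c2 = vector [1, 0, 0, tits_poly n 0 0]"
    "c3 = vector [1, 0, 1, tits_poly n 0 1]"
  have "w c1 \<in> l" "w c2 \<in> l" "w c3 \<in> l"
    unfolding c by (intro w ovoid_vectors_infinity ovoid_vectors_affine)+
  then obtain x y z where xyz: "x \<noteq> 0 \<or> y \<noteq> 0 \<or> z \<noteq> 0" "x *s w c1 + y *s w c2 + z *s w c3 = 0"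
    by (rule dim_2_dependent[OF l])
  have "T (x *s c1 + y *s c2 + z *s c3) + (- (x * f (T c1) + y * f (T c2) + z * f (T c3))) *s v = 0"
    using xyz(2) unfolding w_def add scale by (simp add: algebra_simps)
  then have "x *s c1 + y *s c2 + z *s c3 = 0" using ind by blast
  then show False using xyz(1) by (auto simp: c vec_eq_iff forall_4)
qed

text \<open>The line \<open>l\<close> is not contained in the span of the vertex. A vector
  \<open>u\<close> of \<open>l\<close> outside it lies on a generator, and subtracting the vertex
  part from \<open>u\<close> leaves a nonzero multiple of an ovoid vector in \<Sigma>.\<close>

lemma cone_tangent_point:
  fixes \<Sigma> l :: "('f::field ^ 5) set" and v :: "'f ^ 5"
  assumes l: "vec.subspace l" "vec.dim l = 2" "l \<subseteq> \<Sigma>"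
    and \<Sigma>: "vec.subspace \<Sigma>" "v \<in> \<Sigma>"
    and T: "Vector_Spaces.linear (*s) (*s) T"
    and l_cone: "\<And>u. u \<in> l \<Longrightarrow> u \<noteq> 0 \<Longrightarrow> \<exists>c\<in>ovoid_vectors n. \<exists>k r. u = k *s T c + r *s v"
  obtains c where "c \<in> ovoid_vectors n" "T c \<in> \<Sigma>"
proof -
  have "\<not> l \<subseteq> vec.span {v}"
  proof
    assume "l \<subseteq> vec.span {v}"
    then have "vec.dim l \<le> card {v}" by (intro vec.dim_le_card) auto
    with l(2) show False by simp
  qed
  then obtain u where u: "u \<in> l" "u \<notin> vec.span {v}" by blast
  then have "u \<noteq> 0" using vec.span_zero by metis
  then obtain c k r where c: "c \<in> ovoid_vectors n" "u = k *s T c + r *s v" using l_cone[OF u(1)] by blast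
  have "k \<noteq> 0" using u(2) c(2) by (auto simp: vec.span_singleton)
  have "u - r *s v \<in> \<Sigma>"
    using u(1) l(3) by (intro vec.subspace_diff[OF \<Sigma>(1)] vec.subspace_scale[OF \<Sigma>(1)] \<Sigma>(2)) blast
  then have "k *s T c \<in> \<Sigma>" unfolding c(2) by simp
  then have "(1 / k) *s (k *s T c) \<in> \<Sigma>" by (rule vec.subspace_scale[OF \<Sigma>(1)])
  then have "T c \<in> \<Sigma>" unfolding vec.scale_scale using \<open>k \<noteq> 0\<close> by simp
  with c(1) show ?thesis by (rule that)
qed

text \<open>With the vertex in \<Sigma> and the tangent point moved to \<open>(0, 0, 0, 1)\<close>,
  \<Sigma> misses all other ovoid points. This forces it to be spanned by the vertex and the
  hyperplane \<open>c$1 = 0\<close> of the ovoid space.\<close>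

lemma (in suzuki_field) tits_cone_frame:
  fixes \<Sigma> l :: "('k ^ 5) set" and C :: "('k ^ 5) set set"
  assumes F0: "F0 = (UNIV :: 'k set)" and fin: "finite (UNIV :: 'k set)"
    and \<Sigma>: "\<Sigma> \<in> proj_subspaces 3" and l: "l \<in> proj_lines" "l \<subseteq> \<Sigma>"
    and C: "tits_cone \<sigma> C" and Cl: "C \<inter> points_in \<Sigma> = points_in l"
  obtains v and T :: "'k ^ 4 \<Rightarrow> 'k ^ 5" where
    "Vector_Spaces.linear (*s) (*s) T" "\<And>c r. T c + r *s v = 0 \<Longrightarrow> c = 0 \<and> r = 0"
    "\<And>c r. T c + r *s v \<in> \<Sigma> \<longleftrightarrow> c$1 = 0"
    "\<And>c r. T c + r *s v \<in> l \<longleftrightarrow> c$1 = 0 \<and> c$2 = 0 \<and> c$3 = 0"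
    "\<And>P. P \<in> C - points_in \<Sigma> \<Longrightarrow> \<exists>s t r. P = vec.span {T (vector [1, s, t, tits_poly \<sigma> s t]) + r *s v}"
proof -
  have \<Sigma>': "vec.subspace \<Sigma>" "vec.dim \<Sigma> = 4" and l': "vec.subspace l" "vec.dim l = 2"
    using \<Sigma> l(1) by (auto simp: proj_subspaces_def)
  obtain V H Ov where V: "V \<in> proj_points" and H: "H \<in> proj_subspaces 3" "\<not> V \<subseteq> H"
    and Ov: "tits_ovoid_in \<sigma> H Ov" and CV: "C = cone V Ov"
    using C unfolding tits_cone_def by (elim exE conjE)
  have H': "vec.subspace H" using H(1) by (simp add: proj_subspaces_def)
  obtain v where v: "v \<noteq> 0" "V = vec.span {v}" using V unfolding proj_points_iff by (elim exE conjE)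
  have "v \<notin> H" using H(2) unfolding v(2) span_singleton_subset_iff[OF H'] .
  obtain T0 :: "'k ^ 4 \<Rightarrow> 'k ^ 5" where T0: "Vector_Spaces.linear (*s) (*s) T0" "bij_betw T0 UNIV H"
    and Ov': "Ov = (\<lambda>P. T0 ` P) ` standard_tits_ovoid \<sigma>"
    using Ov unfolding tits_ovoid_in_def by (elim exE conjE)
  have ind0: "c = 0 \<and> r = 0" if 0: "T0 c + r *s v = 0" for c r
  proof -
    have T0c: "T0 c \<in> H" using T0(2) by (auto simp: bij_betw_def)
    have "r = 0"
    proof (rule ccontr)
      assume "r \<noteq> 0"
      have "r *s v = - T0 c" using 0 by (simp add: eq_neg_iff_add_eq_0 add.commute)
      then have "(1 / r) *s (r *s v) \<in> H"
        using T0c by (simp only: vec.subspace_neg[OF H'] vec.subspace_scale[OF H'])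
      then show False using \<open>r \<noteq> 0\<close> \<open>v \<notin> H\<close> unfolding vec.scale_scale by simp
    qed
    then have "T0 c = 0" using 0 by simp
    moreover have "T0 0 = 0" using T0(1) unfolding linear_vec_iff by (metis vec.scale_zero_left)
    moreover have "inj T0" using T0(2) by (simp add: bij_betw_def)
    ultimately show ?thesis using \<open>r = 0\<close> by (metis injD)
  qed
  \<comment> \<open>This and the next two facts hold for any parametrization \<open>T\<close> of the
    base, since they are used before and after the change of coordinates by
    \<open>G\<close>.\<close>
  have C_iff: "vec.span {u} \<in> C \<longleftrightarrow> (\<exists>c\<in>ovoid_vectors \<sigma>. \<exists>k r. u = k *s T c + r *s v)"
    if "Vector_Spaces.linear (*s) (*s) T" "Ov = (\<lambda>P. T ` P) ` standard_tits_ovoid \<sigma>" "u \<noteq> 0"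
    for T :: "'k ^ 4 \<Rightarrow> 'k ^ 5" and u
    unfolding CV v(2) that(2) by (rule span_singleton_in_cone_iff[OF that(1,3)])
  have in_l: "k *s T c + r *s v \<in> l"
    if "Vector_Spaces.linear (*s) (*s) T" "Ov = (\<lambda>P. T ` P) ` standard_tits_ovoid \<sigma>"
      "c \<in> ovoid_vectors \<sigma>" "k *s T c + r *s v \<in> \<Sigma>"
    for T :: "'k ^ 4 \<Rightarrow> 'k ^ 5" and c k r
  proof (cases "k *s T c + r *s v = 0")
    case True
    then show ?thesis using vec.subspace_0[OF l'(1)] by simp
  next
    case False
    have "vec.span {k *s T c + r *s v} \<in> C" unfolding C_iff[OF that(1,2) False] using that(3) by blast
    moreover have "vec.span {k *s T c + r *s v} \<in> points_in \<Sigma>"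
      unfolding span_singleton_in_points_in[OF \<Sigma>'(1) False] by (rule that(4))
    ultimately have "vec.span {k *s T c + r *s v} \<in> points_in l" using Cl by blast
    then show ?thesis unfolding span_singleton_in_points_in[OF l'(1) False] .
  qed
  have l_cone: "\<exists>c\<in>ovoid_vectors \<sigma>. \<exists>k r. u = k *s T c + r *s v"
    if "Vector_Spaces.linear (*s) (*s) T" "Ov = (\<lambda>P. T ` P) ` standard_tits_ovoid \<sigma>" "u \<in> l" "u \<noteq> 0"
    for T :: "'k ^ 4 \<Rightarrow> 'k ^ 5" and u
  proof -
    have "vec.span {u} \<in> points_in l" unfolding span_singleton_in_points_in[OF l'(1) that(4)] by (rule that(3))
    then have "vec.span {u} \<in> C" using Cl by blast
    then show ?thesis unfolding C_iff[OF that(1,2,4)] .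
  qed
  have v\<Sigma>: "v \<in> \<Sigma>"
    by (rule cone_vertex_in_line[OF \<Sigma>' l' T0(1) ind0 in_l[OF T0(1) Ov']])
  obtain c0 where c0: "c0 \<in> ovoid_vectors \<sigma>" "T0 c0 \<in> \<Sigma>"
    by (rule cone_tangent_point[OF l' l(2) \<Sigma>'(1) v\<Sigma> T0(1) l_cone[OF T0(1) Ov']])
  obtain G :: "'k ^ 4 \<Rightarrow> 'k ^ 4" where G: "Vector_Spaces.linear (*s) (*s) G" "bij G"
    "G (vector [0, 0, 0, 1]) = c0" "(\<lambda>P. G ` P) ` standard_tits_ovoid \<sigma> = standard_tits_ovoid \<sigma>"
    by (rule tits_ovoid_transitive[OF F0 fin c0(1)])
  \<comment> \<open>The base and the cone are unchanged, but the tangent point is now the image of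
    \<open>(0, 0, 0, 1)\<close>.\<close>
  define T where "T c = T0 (G c)" for c
  have T: "Vector_Spaces.linear (*s) (*s) T"
    using T0(1) G(1) unfolding linear_vec_iff T_def by simp
  have add: "T (x + y) = T x + T y" and scale: "T (a *s x) = a *s T x" for x y a
    using T unfolding linear_vec_iff by blast+
  have OvT: "Ov = (\<lambda>P. T ` P) ` standard_tits_ovoid \<sigma>"
  proof -
    have "Ov = (\<lambda>P. T0 ` P) ` (\<lambda>P. G ` P) ` standard_tits_ovoid \<sigma>" unfolding Ov' G(4) ..
    then show ?thesis unfolding image_image T_def .
  qed
  have ind: "c = 0 \<and> r = 0" if 0: "T c + r *s v = 0" for c r
  proof -
    have "G c = 0 \<and> r = 0" using ind0 0 unfolding T_def by blast
    moreover have "G 0 = 0" using G(1) unfolding linear_vec_iff by (metis vec.scale_zero_left)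
    ultimately show ?thesis using G(2) by (metis bij_is_inj injD)
  qed
  have vl: "v \<in> l"
    using in_l[OF T OvT ovoid_vectors_infinity, of 0 1] v\<Sigma> by simp
  let ?e1 = "vector [1, 0, 0, 0] :: 'k ^ 4" and ?e2 = "vector [0, 1, 0, 0] :: 'k ^ 4"
    and ?e3 = "vector [0, 0, 1, 0] :: 'k ^ 4" and ?e4 = "vector [0, 0, 0, 1] :: 'k ^ 4"
  have T4: "T ?e4 \<in> \<Sigma>" using c0(2) G(3) by (simp add: T_def)
  have T4l: "T ?e4 \<in> l" using in_l[OF T OvT ovoid_vectors_infinity, of 1 0] T4 by simp
  \<comment> \<open>A second ovoid point in \<Sigma> would lie on \<open>l\<close> together with the
    tangent point and the vertex, giving three independent vectors in dimension 2.\<close>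
  have not_\<Sigma>: "T (vector [1, s, t, tits_poly \<sigma> s t]) \<notin> \<Sigma>" for s t
  proof
    let ?c = "vector [1, s, t, tits_poly \<sigma> s t] :: 'k ^ 4"
    assume "T ?c \<in> \<Sigma>"
    then have Tc: "T ?c \<in> l" using in_l[OF T OvT ovoid_vectors_affine, of 1 s t 0] by simp
    obtain x y z where xyz: "x \<noteq> 0 \<or> y \<noteq> 0 \<or> z \<noteq> 0" "x *s T ?c + y *s T ?e4 + z *s v = 0"
      by (rule dim_2_dependent[OF l' Tc T4l vl])
    then have "x *s ?c + y *s ?e4 = 0 \<and> z = 0" using ind unfolding add[symmetric] scale[symmetric] by blast
    then show False using xyz(1) by (auto simp: vec_eq_iff forall_4)
  qed
  have T1: "T ?e1 \<notin> \<Sigma>"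
    using not_\<Sigma>[of 0 0] by (simp add: tits_poly_def power_0_left)
  have dim: "vec.dim \<Sigma> + 1 = CARD(5)" using \<Sigma>'(2) by simp
  obtain f where f: "\<And>x y. f (x + y) = f x + f y" "\<And>c x. f (c *s x) = c * f x"
    "\<And>x. f x = 0 \<longleftrightarrow> x \<in> \<Sigma>" "f (T ?e1) = (1::'k)"
    by (rule hyperplane_functional[OF \<Sigma>'(1) dim T1]) blast
  have fv: "f v = 0" and fT4: "f (T ?e4) = 0" using v\<Sigma> T4 by (simp_all only: f(3))
  define a2 a3 where a: "a2 = f (T ?e2)" "a3 = f (T ?e3)"
  have fT: "f (T c) = c$1 + c$2 * a2 + c$3 * a3" for c
    by (subst linear_vec_4[OF T]) (simp add: f(1,2,4) fT4 a)
  \<comment> \<open>The functional of \<Sigma> never vanishes at affine ovoid points, whereas a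
    nonzero \<open>a2\<close> or \<open>a3\<close> would produce a zero.\<close>
  have aff: "1 + s * a2 + t * a3 \<noteq> 0" for s t
    using not_\<Sigma>[of s t] unfolding f(3)[symmetric] fT by simp
  have a2: "a2 = 0"
  proof (rule ccontr)
    assume "a2 \<noteq> 0"
    then show False using aff[of "- 1 / a2" 0] by simp
  qed
  have a3: "a3 = 0"
  proof (rule ccontr)
    assume "a3 \<noteq> 0"
    then show False using aff[of 0 "- 1 / a3"] by simp
  qed
  have \<Sigma>_iff: "T c + r *s v \<in> \<Sigma> \<longleftrightarrow> c$1 = 0" for c r
    unfolding f(3)[symmetric] f(1,2) fT a2 a3 fv by simp
  show ?thesis
  proof (rule that[OF T ind \<Sigma>_iff])
    show "T c + r *s v \<in> l \<longleftrightarrow> c$1 = 0 \<and> c$2 = 0 \<and> c$3 = 0" for c r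
    proof
      assume in_l: "T c + r *s v \<in> l"
      show "c$1 = 0 \<and> c$2 = 0 \<and> c$3 = 0"
      proof (cases "T c + r *s v = 0")
        case True
        then show ?thesis using ind by fastforce
      next
        case False
        obtain d k r' where d: "d \<in> ovoid_vectors \<sigma>" "T c + r *s v = k *s T d + r' *s v"
          using l_cone[OF T OvT in_l False] by blast
        \<comment> \<open>Uniqueness of coordinates identifies \<open>c\<close> with a multiple of
          an ovoid vector; as \<open>c$1 = 0\<close>, only the tangent point or the zero multiple is
          possible.\<close>
        have "T (c - k *s d) + (r - r') *s v = 0"
        proof -
          have "T (c - k *s d) = T c - k *s T d"
            using add[of "c - k *s d" "k *s d"] by (simp add: scale)
          then have "T (c - k *s d) + (r - r') *s v = (T c + r *s v) - (k *s T d + r' *s v)"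
            by (simp add: algebra_simps)
          then show ?thesis unfolding d(2) by simp
        qed
        then have c: "c = k *s d" using ind by fastforce
        have "c$1 = 0" using in_l l(2) \<Sigma>_iff by blast
        from d(1) show ?thesis
        proof (cases rule: ovoid_vectors_cases)
          case 1
          then show ?thesis by (simp add: c)
        next
          case (2 s t)
          then have "k = 0" using \<open>c$1 = 0\<close> by (simp add: c)
          then show ?thesis by (simp add: c)
        qed
      qed
    next
      assume "c$1 = 0 \<and> c$2 = 0 \<and> c$3 = 0"
      then have "T c = c$4 *s T ?e4" by (subst linear_vec_4[OF T]) simp
      then show "T c + r *s v \<in> l"
        using vec.subspace_add[OF l'(1) vec.subspace_scale[OF l'(1) T4l] vec.subspace_scale[OF l'(1) vl]] by simp
    qed
    fix P assume P: "P \<in> C - points_in \<Sigma>"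
    then have "P \<in> proj_points" unfolding CV cone_def points_in_def by blast
    then obtain u where u: "u \<noteq> 0" "P = vec.span {u}" unfolding proj_points_iff by (elim exE conjE)
    have "u \<notin> \<Sigma>" using P unfolding u(2) Diff_iff span_singleton_in_points_in[OF \<Sigma>'(1) u(1)] by (rule conjunct2)
    have "vec.span {u} \<in> C" using P u(2) by blast
    then obtain c k r where c: "c \<in> ovoid_vectors \<sigma>" "u = k *s T c + r *s v"
      unfolding C_iff[OF T OvT u(1)] by (elim bexE exE)
    have "k * c$1 \<noteq> 0"
      using \<open>u \<notin> \<Sigma>\<close> \<Sigma>_iff[of "k *s c" r] unfolding c(2) scale by simp
    with c(1) obtain s t where st: "c = vector [1, s, t, tits_poly \<sigma> s t]" and k: "k \<noteq> 0"
      by (cases rule: ovoid_vectors_cases) auto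
    have "u = k *s (T c + (r / k) *s v)"
      unfolding c(2) vec.scale_right_distrib vec.scale_scale using k by simp
    then have "P = vec.span {T c + (r / k) *s v}"
      unfolding u(2) using k by (simp only: span_singleton_scale not_False_eq_True)
    then show "\<exists>s t r. P = vec.span {T (vector [1, s, t, tits_poly \<sigma> s t]) + r *s v}"
      unfolding st by blast
  qed
qed

section \<open>Normal form of Buekenhout-Tits unitals\<close>

text \<open>The elements of \<open>F0\<close> are roots of the polynomial
  \<open>X ^ q - X\<close>.\<close>

lemma (in suzuki_field) card_F0_le:
  assumes "finite (UNIV :: 'k set)"
  shows "card F0 \<le> q"
proof -
  let ?p = "monom 1 q - monom 1 1 :: 'k poly"
  have q: "q > 1" unfolding q_eq by (rule one_less_power) simp_all
  have "coeff ?p q = 1" using q by simp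
  then have p0: "?p \<noteq> 0" by (metis coeff_0 zero_neq_one)
  have "F0 = {x. poly ?p x = 0}" by (auto simp: F0_def poly_monom)
  then have "card F0 \<le> degree ?p" using card_poly_roots_bound[OF p0] by simp
  also have "\<dots> \<le> q" using q by (intro degree_diff_le) (simp_all add: degree_monom_eq)
  finally show ?thesis .
qed

text \<open>The range consists of fixed points of the \<open>q\<close>-power map and already has
  \<open>q\<close> elements, so every embedding has the same image.\<close>

lemma (in suzuki_field) F0_eq_range:
  fixes \<iota> :: "'f::{field,finite} \<Rightarrow> 'k"
  assumes fin: "finite (UNIV :: 'k set)" and card: "CARD('f) = q"
    and \<iota>: "\<iota> 1 = 1" "\<And>x y. \<iota> (x * y) = \<iota> x * \<iota> y" "inj \<iota>"
  shows "F0 = range \<iota>"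
proof -
  have pow: "\<iota> (x ^ n) = \<iota> x ^ n" for x n
    by (induction n) (simp_all add: \<iota>)
  have "range \<iota> \<subseteq> F0"
    using finite_field_power_card[where ?'a = 'f] by (auto simp: F0_def card simp flip: pow)
  moreover have "card F0 \<le> card (range \<iota>)"
    using card_F0_le[OF fin] card \<iota>(3) by (simp add: card_image)
  moreover have "finite F0" using fin by (rule rev_finite_subset) simp
  ultimately show ?thesis by (metis card_seteq)
qed

text \<open>The \<open>q\<^sup>2\<close> combinations are distinct, because a coincidence would
  express \<epsilon> as a quotient in \<open>F0\<close>; hence they exhaust the field.\<close>

lemma (in suzuki_field) F0_basis:
  assumes fin: "finite (UNIV :: 'k set)" and card: "CARD('k) = q\<^sup>2" "card F0 = q" and \<epsilon>: "\<epsilon> \<notin> F0"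
  shows "\<exists>a\<in>F0. \<exists>b\<in>F0. x = a + b * \<epsilon>"
proof -
  let ?g = "\<lambda>(a, b). a + b * \<epsilon>"
  have "inj_on ?g (F0 \<times> F0)"
  proof (intro inj_onI, clarify)
    fix a b a' b' assume F: "a \<in> F0" "b \<in> F0" "a' \<in> F0" "b' \<in> F0" and eq: "a + b * \<epsilon> = a' + b' * \<epsilon>"
    have "b = b'"
    proof (rule ccontr)
      assume "b \<noteq> b'"
      then have "\<epsilon> = (a' - a) / (b - b')" using eq by (simp add: field_simps)
      then show False using F \<epsilon> by (metis F0_closed(4,6))
    qed
    with eq show "a = a' \<and> b = b'" by simp
  qed
  then have "card (?g ` (F0 \<times> F0)) = CARD('k)"
    by (simp add: card_image card_cartesian_product card power2_eq_square)
  then have "?g ` (F0 \<times> F0) = UNIV"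
    using fin by (metis card_subset_eq subset_UNIV)
  then have "x \<in> ?g ` (F0 \<times> F0)" by simp
  then show ?thesis by auto
qed

definition (in suzuki_field) bt_points :: "'k \<Rightarrow> ('k ^ 3) set" where
  "bt_points \<epsilon> = insert (vector [0, 0, 1]) ((\<lambda>(s, t, r). bt_vector \<epsilon> \<epsilon> 0 s t r) ` (F0 \<times> F0 \<times> F0))"

text \<open>An upper bound is enough: the exact cardinality of a unital later turns an inclusion
  into an equality.\<close>

lemma (in suzuki_field) card_bt_points_le:
  assumes "finite F0" "card F0 = q"
  shows "finite (bt_points \<epsilon>)" "card (bt_points \<epsilon>) \<le> q ^ 3 + 1"
proof -
  show "finite (bt_points \<epsilon>)" unfolding bt_points_def using assms by simp
  have "card ((\<lambda>(s, t, r). bt_vector \<epsilon> \<epsilon> 0 s t r) ` (F0 \<times> F0 \<times> F0)) \<le> card (F0 \<times> F0 \<times> F0)"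
    using assms by (intro card_image_le) simp
  also have "\<dots> = q ^ 3" using assms(2) by (simp add: card_cartesian_product power3_eq_cube)
  finally show "card (bt_points \<epsilon>) \<le> q ^ 3 + 1"
    unfolding bt_points_def by (intro card_insert_le_m1) simp_all
qed

text \<open>The basis of \<Sigma> over \<open>'k\<close> is adapted to the cone. The constants
  \<open>y\<close>, \<open>w\<close>, \<open>\<gamma>\<close> record the images of the last two
  basis vectors of the ovoid space, and the field map of \<phi> is then applied to them.\<close>

lemma incidence_iso_image_tits_unital:
  fixes \<Sigma> :: "('f::{field,finite} ^ 5) set" and \<phi> :: "('f ^ 5) set \<Rightarrow> ('k::{field,finite} ^ 3) set"
  assumes q: "q = 2 ^ (2 * e + 1)" and cards: "CARD('f) = q" "CARD('k) = q\<^sup>2"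
    and \<Sigma>: "\<Sigma> \<in> proj_subspaces 3" and S: "desarguesian_spread TYPE('k) \<Sigma> S"
    and \<phi>: "incidence_iso (abb_points \<Sigma> S) (abb_lines \<Sigma> S) proj_points proj_lines \<phi>"
    and C: "tits_cone (2 ^ (e + 1)) C" and l: "l \<in> S" "C \<inter> points_in \<Sigma> = points_in l"
  obtains A :: "'k ^ 3 ^ 3" and y \<gamma> w where "invertible A"
    "y \<notin> suzuki_field.F0 q" "\<gamma> \<notin> suzuki_field.F0 q" "card (suzuki_field.F0 q :: 'k set) = q"
    "\<phi> ` insert l (C - points_in \<Sigma>) \<subseteq> insert (vec.span {A *v vector [0, 0, 1]})
      {vec.span {A *v suzuki_field.bt_vector e y \<gamma> w s t r} | s t r.
        s \<in> suzuki_field.F0 q \<and> t \<in> suzuki_field.F0 q \<and> r \<in> suzuki_field.F0 q}"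
proof -
  have "CARD('k) = 2 ^ ((2 * e + 1) * 2)" using q cards(2) by (simp only: power_mult)
  then have two_K: "1 + 1 = (0::'k)" by (rule one_plus_one_eq_0_if_card_power_2)
  have "CARD('f) = 2 ^ (2 * e + 1)" unfolding cards(1) by (rule q)
  then have two_F: "1 + 1 = (0::'f)" by (rule one_plus_one_eq_0_if_card_power_2)
  interpret K: suzuki_field e q "TYPE('k)"
    by unfold_locales (rule two_K, rule q)
  interpret F: suzuki_field e q "TYPE('f)"
    by unfold_locales (rule two_F, rule q)
  have F_F0: "F.F0 = UNIV"
    using finite_field_power_card[where ?'a = 'f] by (simp add: F.F0_def cards(1))
  have lS: "l \<in> proj_lines" "l \<subseteq> \<Sigma>" and spread: "S \<subseteq> proj_lines"
    using S l(1) unfolding desarguesian_spread_def line_spread_def by auto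
  obtain v and T :: "'f ^ 4 \<Rightarrow> 'f ^ 5" where T: "Vector_Spaces.linear (*s) (*s) T"
    and ind: "\<And>c r. T c + r *s v = 0 \<Longrightarrow> c = 0 \<and> r = 0"
    and \<Sigma>_iff: "\<And>c r. T c + r *s v \<in> \<Sigma> \<longleftrightarrow> c$1 = 0"
    and l_iff: "\<And>c r. T c + r *s v \<in> l \<longleftrightarrow> c$1 = 0 \<and> c$2 = 0 \<and> c$3 = 0"
    and aff: "\<And>P. P \<in> C - points_in \<Sigma> \<Longrightarrow> \<exists>s t r. P = vec.span {T (vector [1, s, t, tits_poly F.\<sigma> s t]) + r *s v}"
    by (rule F.tits_cone_frame[OF F_F0 finite \<Sigma> lS C[folded F.\<sigma>_def] l(2)]) blast
  have T_add: "T (x + y) = T x + T y" and T_scale: "T (a *s x) = a *s T x" for x y a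
    using T unfolding linear_vec_iff by blast+
  have T0: "T 0 = 0" using T_scale[of 0 0] by simp
  obtain \<iota> :: "'f \<Rightarrow> 'k" and \<beta> where \<iota>: "\<iota> 1 = 1" "\<forall>x y. \<iota> (x + y) = \<iota> x + \<iota> y" "\<forall>x y. \<iota> (x * y) = \<iota> x * \<iota> y"
    and \<beta>: "\<forall>u v. \<beta> (u + v) = \<beta> u + \<beta> v" "\<forall>c v. \<beta> (\<iota> c *s v) = c *s \<beta> v" "bij_betw \<beta> UNIV \<Sigma>"
    and S_eq: "S = (\<lambda>P. \<beta> ` P) ` (proj_points :: ('k ^ 2) set set)"
    using S unfolding desarguesian_spread_def by (elim conjE exE)
  have \<beta>0: "\<beta> 0 = 0"
    using \<beta>(1)[rule_format, of 0 0] by simp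
  have \<beta>_inj: "\<beta> u = \<beta> u' \<longleftrightarrow> u = u'" for u u' using \<beta>(3) by (auto simp: bij_betw_def inj_def)
  obtain P where "P \<in> proj_points" "l = \<beta> ` P" using l(1) unfolding S_eq by blast
  then obtain p where p: "p \<noteq> 0" "l = \<beta> ` vec.span {p}" unfolding proj_points_iff by blast
  let ?e1 = "vector [1, 0, 0, 0] :: 'f ^ 4" and ?e2 = "vector [0, 1, 0, 0] :: 'f ^ 4"
    and ?e3 = "vector [0, 0, 1, 0] :: 'f ^ 4" and ?e4 = "vector [0, 0, 0, 1] :: 'f ^ 4"
  have "v \<in> l" using l_iff[of 0 1] T0 by simp
  then obtain m where m: "v = \<beta> (m *s p)" unfolding p(2) vec.span_singleton by blast
  \<comment> \<open>Rescaled so that \<beta> sends \<open>p2\<close> to the vertex itself and not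
    just to some vector of \<open>l\<close>.\<close>
  define p2 where "p2 = m *s p"
  have "m \<noteq> 0"
  proof
    assume "m = 0"
    then have "v = 0" using m \<beta>0 by simp
    then show False using ind[of 0 1] T0 by simp
  qed
  then have l_eq: "l = \<beta> ` vec.span {p2}" unfolding p(2) p2_def by (simp only: span_singleton_scale not_False_eq_True)
  have v_eq: "v = \<beta> p2" unfolding m p2_def ..
  have in_\<beta>: "\<exists>u. x = \<beta> u" if "x \<in> \<Sigma>" for x using that \<beta>(3) by (auto simp: bij_betw_def)
  have "T ?e2 \<in> \<Sigma>" using \<Sigma>_iff[of ?e2 0] by simp
  then obtain p1 where p1: "T ?e2 = \<beta> p1" using in_\<beta> by blast
  \<comment> \<open>As \<open>l\<close> corresponds to the span of \<open>p2\<close> over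
    \<open>'k\<close>, this makes \<open>p1\<close> and \<open>p2\<close> independent over the large
    field.\<close>
  have "T ?e2 \<notin> l" using l_iff[of ?e2 0] by simp
  then have p1_not: "p1 \<notin> vec.span {p2}" unfolding l_eq p1 by blast
  have p2_0: "p2 \<noteq> 0" using p(1) \<open>m \<noteq> 0\<close> by (simp add: p2_def)
  have "vec.dim {p1, p2} = 2" using p1_not p2_0 by (simp add: vec.dim_insert)
  then have "vec.span {p1, p2} = vec.span UNIV"
    using vec_dim_card[where ?'a = 'k and ?'n = 2] by (intro vec.dim_eq_span) simp_all
  then have span: "u \<in> vec.span {p1, p2}" for u by (simp only: vec.span_UNIV UNIV_I)
  have coords: "\<exists>x z. u = x *s p1 + z *s p2" for u
  proof -
    obtain x where "u - x *s p1 \<in> vec.span {p2}" using span[of u] unfolding vec.span_breakdown_eq[of u] by blast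
    then obtain z where "u - x *s p1 = z *s p2" unfolding vec.span_singleton by blast
    then have "u = x *s p1 + z *s p2" by (simp add: algebra_simps)
    then show ?thesis by blast
  qed
  have p_ind: "x = 0 \<and> z = 0" if 0: "x *s p1 + z *s p2 = 0" for x z
  proof -
    have "x = 0"
    proof (rule ccontr)
      assume "x \<noteq> 0"
      have "x *s p1 = (- z) *s p2"
        using 0 by (simp only: vec.scale_minus_left eq_neg_iff_add_eq_0)
      then have "(1 / x) *s (x *s p1) = ((1 / x) * (- z)) *s p2" by (simp only: vec.scale_scale)
      then have "p1 = ((1 / x) * (- z)) *s p2" using \<open>x \<noteq> 0\<close> unfolding vec.scale_scale by simp
      then show False using p1_not unfolding vec.span_singleton by blast
    qed
    with 0 p2_0 show ?thesis by simp
  qed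
  \<comment> \<open>In these coordinates the second basis vector becomes \<open>b 1 0\<close>, the
    vertex \<open>b 0 1\<close>, and \<open>l\<close> is the spread line through
    \<open>b 0 1\<close>.\<close>
  define b where "b x z = \<beta> (x *s p1 + z *s p2)" for x z
  have h: "T ?e1 \<notin> \<Sigma>" using \<Sigma>_iff[of ?e1 0] by simp
  interpret abb: abb_coordinates \<Sigma> S \<iota> b "T ?e1"
  proof
    show "\<Sigma> \<in> proj_subspaces 3" "S \<subseteq> proj_lines" "T ?e1 \<notin> \<Sigma>" by fact+
    show "\<iota> 1 = 1" "\<iota> (c + d) = \<iota> c + \<iota> d" "\<iota> (c * d) = \<iota> c * \<iota> d" for c d
      using \<iota> by blast+
    show "b (x + x') (z + z') = b x z + b x' z'" for x x' z z'
    proof -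
      have "(x + x') *s p1 + (z + z') *s p2 = (x *s p1 + z *s p2) + (x' *s p1 + z' *s p2)"
        by (simp add: algebra_simps)
      then show ?thesis unfolding b_def using \<beta>(1) by simp
    qed
    show "b (\<iota> c * x) (\<iota> c * z) = c *s b x z" for c x z
    proof -
      have "(\<iota> c * x) *s p1 + (\<iota> c * z) *s p2 = \<iota> c *s (x *s p1 + z *s p2)"
        by (simp only: vec.scale_right_distrib vec.scale_scale)
      then show ?thesis unfolding b_def using \<beta>(2) by metis
    qed
    show "b x z = 0 \<Longrightarrow> x = 0 \<and> z = 0" for x z
      using \<beta>_inj[of "x *s p1 + z *s p2" 0] \<beta>0 p_ind unfolding b_def by simp
    show "u \<in> \<Sigma> \<longleftrightarrow> (\<exists>x z. u = b x z)" for u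
    proof
      assume "u \<in> \<Sigma>"
      then obtain u' where "u = \<beta> u'" using in_\<beta> by blast
      then show "\<exists>x z. u = b x z" unfolding b_def using coords[of u'] by blast
    next
      assume "\<exists>x z. u = b x z"
      then show "u \<in> \<Sigma>" unfolding b_def using \<beta>(3) by (auto simp: bij_betw_def)
    qed
    have b_image: "\<beta> ` vec.span {x *s p1 + z *s p2} = {b (k * x) (k * z) | k. True}" for x z
    proof -
      have "k *s (x *s p1 + z *s p2) = (k * x) *s p1 + (k * z) *s p2" for k
        by (simp only: vec.scale_right_distrib vec.scale_scale)
      then show ?thesis unfolding vec.span_singleton b_def by (auto simp: image_image)
    qed
    show "l \<in> S \<longleftrightarrow> (\<exists>x z. (x \<noteq> 0 \<or> z \<noteq> 0) \<and> l = {b (k * x) (k * z) | k. True})" for l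
    proof
      assume "l \<in> S"
      then obtain P where "P \<in> proj_points" "l = \<beta> ` P" unfolding S_eq by blast
      then obtain u where u: "u \<noteq> 0" "l = \<beta> ` vec.span {u}" unfolding proj_points_iff by blast
      obtain x z where xz: "u = x *s p1 + z *s p2" using coords by blast
      have "x \<noteq> 0 \<or> z \<noteq> 0" using u(1) xz by auto
      then show "\<exists>x z. (x \<noteq> 0 \<or> z \<noteq> 0) \<and> l = {b (k * x) (k * z) | k. True}"
        using u(2) unfolding xz b_image by blast
    next
      assume "\<exists>x z. (x \<noteq> 0 \<or> z \<noteq> 0) \<and> l = {b (k * x) (k * z) | k. True}"
      then obtain x z where xz: "x \<noteq> 0 \<or> z \<noteq> 0" "l = {b (k * x) (k * z) | k. True}" by blast
      have "x *s p1 + z *s p2 \<noteq> 0" using p_ind xz(1) by blast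
      then have "vec.span {x *s p1 + z *s p2} \<in> proj_points" unfolding proj_points_iff by blast
      then show "l \<in> S" unfolding xz(2) b_image[symmetric] S_eq by blast
    qed
  qed
  have l_abb: "l = abb.abb (vector [0, 0, 1])"
    unfolding l_eq abb.abb_def vec.span_singleton by (auto simp: b_def image_image)
  have F0: "K.F0 = range \<iota>"
    by (rule K.F0_eq_range[of \<iota>]) (simp_all add: cards(1) abb.iota_1 abb.iota_mult inj_def)
  have card_F0: "card K.F0 = q"
    unfolding F0 using cards(1) by (simp add: card_image inj_def)
  have T_b: "\<exists>x z. T c = b x z" if "c$1 = 0" for c
    using \<Sigma>_iff[of c 0] that abb.Sigma_iff[of "T c"] by simp
  obtain y w where yw: "T ?e3 = b y w" using T_b[of ?e3] by auto
  obtain \<gamma> where \<gamma>: "T ?e4 = b 0 \<gamma>"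
  proof -
    have "T ?e4 \<in> l" using l_iff[of ?e4 0] by simp
    then obtain k where "T ?e4 = \<beta> (k *s p2)" unfolding l_eq vec.span_singleton by blast
    then have "T ?e4 = b 0 k" by (simp add: b_def)
    then show ?thesis by (rule that)
  qed
  have v_b: "v = b 0 1" and e2_b: "T ?e2 = b 1 0" by (simp_all add: b_def v_eq p1)
  \<comment> \<open>For \<open>y = \<iota> c\<close>, the image of \<open>?e3 - c *s ?e2\<close>
    would be \<open>b 0 w\<close>, a vector of \<open>l\<close>, contrary to
    \<open>l_iff\<close>.\<close>
  have y: "y \<notin> K.F0"
  proof
    assume "y \<in> K.F0"
    then obtain c where c: "y = \<iota> c" unfolding F0 by blast
    have "T (?e3 + (- c) *s ?e2) = b y w + (- c) *s b 1 0"
      unfolding T_add T_scale yw e2_b ..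
    also have "\<dots> = b 0 w"
      unfolding abb.b_scale[symmetric] abb.b_add[symmetric] c abb.iota_minus by simp
    also have "\<dots> \<in> l" unfolding b_def l_eq vec.span_singleton by auto
    finally show False using l_iff[of "?e3 + (- c) *s ?e2" 0] by simp
  qed
  \<comment> \<open>Otherwise the tangent point and the vertex would coincide, contrary to
    \<open>ind\<close>.\<close>
  have \<gamma>': "\<gamma> \<notin> K.F0"
  proof
    assume "\<gamma> \<in> K.F0"
    then obtain c where c: "\<gamma> = \<iota> c" unfolding F0 by blast
    have "T ?e4 + (- c) *s v = 0"
      unfolding \<gamma> v_b abb.b_scale[symmetric] abb.b_add[symmetric] c abb.iota_minus by simp
    then show False using ind by (fastforce simp: vec_eq_iff forall_4)
  qed
  show ?thesis
  proof (rule abb.incidence_iso_semilinear[OF \<phi>])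
    fix A :: "'k ^ 3 ^ 3" and \<theta> :: "'k \<Rightarrow> 'k"
    assume A: "invertible A" and \<theta>: "\<theta> 1 = 1" "\<And>x y. \<theta> (x + y) = \<theta> x + \<theta> y" "\<And>x y. \<theta> (x * y) = \<theta> x * \<theta> y"
      and \<phi>1: "\<And>x z. \<phi> (abb.abb (vector [1, x, z])) = vec.span {A *v vector [1, \<theta> x, \<theta> z]}"
      and \<phi>0: "\<phi> (abb.abb (vector [0, 0, 1])) = vec.span {A *v vector [0, 0, 1]}"
    have \<theta>_0: "\<theta> 0 = 0" using \<theta>(2)[of 0 0] by simp
    have \<theta>_inj: "\<theta> x = \<theta> z \<longleftrightarrow> x = z" for x z
    proof
      assume "\<theta> x = \<theta> z"
      then have 0: "\<theta> (x - z) = 0" using \<theta>(2)[of "x - z" z] by simp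
      show "x = z"
      proof (rule ccontr)
        assume "x \<noteq> z"
        then show False using \<theta>(1) \<theta>(3)[of "x - z" "1 / (x - z)"] 0 by simp
      qed
    qed simp
    have \<theta>_pow: "\<theta> (x ^ n) = \<theta> x ^ n" and \<iota>_pow: "\<iota> (c ^ n) = \<iota> c ^ n" for x c n
      by (induction n) (simp_all add: \<theta> \<iota>)
    have \<theta>_F0: "\<theta> x \<in> K.F0 \<longleftrightarrow> x \<in> K.F0" for x
      by (simp add: K.F0_def \<theta>_inj flip: \<theta>_pow)
    show thesis
    proof (rule that[OF A])
      show "\<theta> y \<notin> K.F0" "\<theta> \<gamma> \<notin> K.F0" using y \<gamma>' by (simp_all only: \<theta>_F0 not_False_eq_True)
      show "card K.F0 = q" by (rule card_F0)
      show "\<phi> ` insert l (C - points_in \<Sigma>) \<subseteq> insert (vec.span {A *v vector [0, 0, 1]})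
        {vec.span {A *v K.bt_vector (\<theta> y) (\<theta> \<gamma>) (\<theta> w) s t r} | s t r. s \<in> K.F0 \<and> t \<in> K.F0 \<and> r \<in> K.F0}"
        (is "_ \<subseteq> insert _ ?U")
      proof
        fix Q assume "Q \<in> \<phi> ` insert l (C - points_in \<Sigma>)"
        then consider "Q = \<phi> l" | P where "P \<in> C - points_in \<Sigma>" "Q = \<phi> P" by blast
        then show "Q \<in> insert (vec.span {A *v vector [0, 0, 1]}) ?U"
        proof cases
          case 1
          then show ?thesis unfolding l_abb \<phi>0 by simp
        next
          case 2
          obtain s t r where P: "P = vec.span {T (vector [1, s, t, tits_poly F.\<sigma> s t]) + r *s v}"
            using aff[OF 2(1)] by blast
          let ?f = "tits_poly F.\<sigma> s t"
          let ?x = "\<iota> s + \<iota> t * y" and ?z = "\<iota> r + \<iota> ?f * \<gamma> + \<iota> t * w"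
          have "T (vector [1, s, t, ?f]) + r *s v =
              T ?e1 + s *s b 1 0 + t *s b y w + ?f *s b 0 \<gamma> + r *s b 0 1"
            by (subst linear_vec_4[OF T]) (simp add: e2_b yw \<gamma> v_b)
          also have "\<dots> = T ?e1 + (b (\<iota> s * 1) (\<iota> s * 0) + b (\<iota> t * y) (\<iota> t * w)
              + b (\<iota> ?f * 0) (\<iota> ?f * \<gamma>) + b (\<iota> r * 0) (\<iota> r * 1))"
            unfolding abb.b_scale by (simp only: add.assoc)
          also have "\<dots> = T ?e1 + b ?x ?z"
            unfolding abb.b_add[symmetric] by (simp add: algebra_simps)
          finally have "P = abb.abb (vector [1, ?x, ?z])"
            unfolding P abb.abb_def by simp
          then have Q: "Q = vec.span {A *v vector [1, \<theta> ?x, \<theta> ?z]}" using 2(2) \<phi>1 by simp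
          \<comment> \<open>Field homomorphisms commute with the Tits polynomial, so \<theta> only
            relabels the parameters in \<open>F0\<close> and moves the three constants.\<close>
          have "\<theta> (\<iota> ?f) = tits_poly K.\<sigma> (\<theta> (\<iota> s)) (\<theta> (\<iota> t))"
            unfolding tits_poly_def by (simp add: \<theta> abb.iota_add abb.iota_mult \<theta>_pow \<iota>_pow K.\<sigma>_def F.\<sigma>_def)
          then have "vector [1, \<theta> ?x, \<theta> ?z] = K.bt_vector (\<theta> y) (\<theta> \<gamma>) (\<theta> w) (\<theta> (\<iota> s)) (\<theta> (\<iota> t)) (\<theta> (\<iota> r))"
            unfolding K.bt_vector_def by (simp add: \<theta>)
          then have "Q = vec.span {A *v K.bt_vector (\<theta> y) (\<theta> \<gamma>) (\<theta> w) (\<theta> (\<iota> s)) (\<theta> (\<iota> t)) (\<theta> (\<iota> r))}"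
            unfolding Q by (simp only:)
          moreover have "\<theta> (\<iota> c) \<in> K.F0" for c by (simp only: \<theta>_F0) (simp add: F0)
          ultimately have "Q \<in> ?U" by blast
          then show ?thesis by simp
        qed
      qed
    qed
  qed
qed

text \<open>The coordinate description is composed with the normalization of its constants; the
  resulting set of vectors depends only on \<epsilon>, not on \<open>U\<close>.\<close>

lemma tits_unital_normalization:
  fixes U :: "('k::{field,finite} ^ 3) set set"
  assumes q: "q = 2 ^ (2 * e + 1)" and cards: "CARD('f::{field,finite}) = q" "CARD('k) = q\<^sup>2"
    and U: "buekenhout_tits_unital TYPE('f) e U" and \<epsilon>: "\<epsilon> \<notin> suzuki_field.F0 q"
  obtains N :: "'k ^ 3 ^ 3" where "invertible N"
    "U = (\<lambda>u. vec.span {N *v u}) ` suzuki_field.bt_points e q \<epsilon>"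
proof -
  have "CARD('k) = 2 ^ ((2 * e + 1) * 2)" using q cards(2) by (simp only: power_mult)
  then have "1 + 1 = (0::'k)" by (rule one_plus_one_eq_0_if_card_power_2)
  then interpret suzuki_field e q "TYPE('k)"
    using q by unfold_locales
  obtain \<Sigma> :: "('f ^ 5) set" and S \<phi> C l where \<Sigma>: "\<Sigma> \<in> proj_subspaces 3"
    and S: "desarguesian_spread TYPE('k) \<Sigma> S"
    and \<phi>: "incidence_iso (abb_points \<Sigma> S) (abb_lines \<Sigma> S) (proj_points :: ('k ^ 3) set set) proj_lines \<phi>"
    and C: "tits_cone (2 ^ (e + 1)) C" and l: "l \<in> S" "C \<inter> points_in \<Sigma> = points_in l"
    and U_eq: "U = \<phi> ` insert l (C - points_in \<Sigma>)" and unital: "unital CARD('f) U"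
    using U unfolding buekenhout_tits_unital_def by (elim conjE exE)
  show ?thesis
  proof (rule incidence_iso_image_tits_unital[OF q cards \<Sigma> S \<phi> C l])
    fix A :: "'k ^ 3 ^ 3" and y \<gamma> w
    assume A: "invertible A" and y: "y \<notin> F0" and \<gamma>: "\<gamma> \<notin> F0" and card_F0: "card F0 = q"
      and "\<phi> ` insert l (C - points_in \<Sigma>) \<subseteq> insert (vec.span {A *v vector [0, 0, 1]})
        {vec.span {A *v bt_vector y \<gamma> w s t r} | s t r. s \<in> F0 \<and> t \<in> F0 \<and> r \<in> F0}"
    then have sub: "U \<subseteq> insert (vec.span {A *v vector [0, 0, 1]})
        {vec.span {A *v bt_vector y \<gamma> w s t r} | s t r. s \<in> F0 \<and> t \<in> F0 \<and> r \<in> F0}"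
      unfolding U_eq by blast
    have basis: "\<exists>a\<in>F0. \<exists>b\<in>F0. x = a + b * \<epsilon>" for x
      by (rule F0_basis[OF finite cards(2) card_F0 \<epsilon>])
    show thesis
    proof (rule bt_vector_normalization[OF basis y \<gamma>, of w])
      fix M :: "'k ^ 3 ^ 3" and \<xi>
      assume M: "invertible M" and \<xi>: "\<xi> \<noteq> 0" "M *v vector [0, 0, 1] = \<xi> *s vector [0, 0, 1]"
        and bt: "\<And>s t r. s \<in> F0 \<Longrightarrow> t \<in> F0 \<Longrightarrow> r \<in> F0 \<Longrightarrow>
          \<exists>s'\<in>F0. \<exists>t'\<in>F0. \<exists>r'\<in>F0. bt_vector y \<gamma> w s t r = M *v bt_vector \<epsilon> \<epsilon> 0 s' t' r'"
      let ?F = "\<lambda>u. vec.span {(A ** M) *v u}"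
      have "U \<subseteq> ?F ` bt_points \<epsilon>"
      proof
        fix Q assume "Q \<in> U"
        then consider "Q = vec.span {A *v vector [0, 0, 1]}"
          | s t r where "s \<in> F0" "t \<in> F0" "r \<in> F0" "Q = vec.span {A *v bt_vector y \<gamma> w s t r}"
          using sub by blast
        then show "Q \<in> ?F ` bt_points \<epsilon>"
        proof cases
          case 1
          have "(A ** M) *v vector [0, 0, 1] = \<xi> *s (A *v vector [0, 0, 1])"
            unfolding matrix_vector_mul_assoc[symmetric] \<xi>(2) by (rule vector_scalar_commute)
          then have "Q = ?F (vector [0, 0, 1])"
            unfolding 1 by (simp only: span_singleton_scale[OF \<xi>(1)])
          moreover have "vector [0, 0, 1] \<in> bt_points \<epsilon>" by (simp add: bt_points_def)
          ultimately show ?thesis by (rule image_eqI)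
        next
          case 2
          obtain s' t' r' where b: "s' \<in> F0" "t' \<in> F0" "r' \<in> F0"
            "bt_vector y \<gamma> w s t r = M *v bt_vector \<epsilon> \<epsilon> 0 s' t' r'"
            using bt[OF 2(1-3)] by (elim bexE)
          have "Q = ?F (bt_vector \<epsilon> \<epsilon> 0 s' t' r')"
            unfolding 2(4) b(4) matrix_vector_mul_assoc ..
          moreover have "bt_vector \<epsilon> \<epsilon> 0 s' t' r' \<in> bt_points \<epsilon>"
            unfolding bt_points_def using b(1-3)
            by (intro insertI2 image_eqI[of _ _ "(s', t', r')"]) simp_all
          ultimately show ?thesis by (rule image_eqI)
        qed
      qed
      \<comment> \<open>The image of \<open>bt_points \<epsilon>\<close> has at most
        \<open>q ^ 3 + 1\<close> elements, the size of \<open>U\<close>, so the inclusion is an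
        equality.\<close>
      moreover have fin: "finite (bt_points \<epsilon>)" and "card (bt_points \<epsilon>) \<le> q ^ 3 + 1"
        using card_bt_points_le[OF _ card_F0] by simp_all
      then have "card (?F ` bt_points \<epsilon>) \<le> card U"
        using card_image_le[OF fin, of ?F] unital cards(1) by (simp add: unital_def)
      ultimately have "U = ?F ` bt_points \<epsilon>" using fin by (intro card_seteq) simp_all
      with invertible_mult[OF A M] show thesis by (rule that)
    qed
  qed
qed

theorem theorem1:
  fixes e q :: nat
    and U1 U2 :: "('k::{field,finite} ^ 3) set set"
  assumes "e \<ge> 1"
    and "q = 2 ^ (2 * e + 1)"
    and "CARD('f::{field,finite}) = q"
    and "CARD('k) = q ^ 2"
    and "buekenhout_tits_unital TYPE('f) e U1"
    and "buekenhout_tits_unital TYPE('f) e U2"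
  shows "\<exists>g \<in> PGL. g ` U1 = U2"
proof -
  have "CARD('k) = 2 ^ ((2 * e + 1) * 2)" using assms(2,4) by (simp only: power_mult)
  then have "1 + 1 = (0::'k)" by (rule one_plus_one_eq_0_if_card_power_2)
  then interpret suzuki_field e q "TYPE('k)"
    using assms(2) by unfold_locales
  have "q > 1" unfolding assms(2) by (rule one_less_power) simp_all
  then have "card F0 < CARD('k)"
    using card_F0_le assms(4) by (simp add: power2_eq_square le_less_trans)
  \<comment> \<open>One common \<epsilon> is fixed so that both unitals are images of the same set
    of vectors.\<close>
  then obtain \<epsilon> where \<epsilon>: "\<epsilon> \<notin> F0" by (metis UNIV_eq_I less_irrefl)
  obtain N1 where N1: "invertible N1" and U1: "U1 = (\<lambda>u. vec.span {N1 *v u}) ` bt_points \<epsilon>"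
    by (rule tits_unital_normalization[OF assms(2-5) \<epsilon>])
  obtain N2 where N2: "invertible N2" and U2: "U2 = (\<lambda>u. vec.span {N2 *v u}) ` bt_points \<epsilon>"
    by (rule tits_unital_normalization[OF assms(2-4,6) \<epsilon>])
  obtain B where B: "B ** N1 = mat 1" "N1 ** B = mat 1" using N1 unfolding invertible_def by blast
  then have "invertible B" unfolding invertible_def by blast
  \<comment> \<open>Passing from \<open>U1\<close> back to the common normal form by the inverse of
    \<open>N1\<close>, then to \<open>U2\<close> by \<open>N2\<close>.\<close>
  define g where "g = restrict (\<lambda>P. (*v) (N2 ** B) ` P) (proj_points :: ('k ^ 3) set set)"
  have "g \<in> PGL"
    unfolding PGL_def g_def using invertible_mult[OF N2 \<open>invertible B\<close>] by blast
  moreover have "g ` U1 = U2"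
  proof -
    have U1_points: "U1 \<subseteq> proj_points"
      using assms(5) by (simp add: buekenhout_tits_unital_def unital_def)
    have "g (vec.span {N1 *v u}) = vec.span {N2 *v u}" if "u \<in> bt_points \<epsilon>" for u
    proof -
      have "vec.span {N1 *v u} \<in> proj_points" using U1_points that unfolding U1 by blast
      then have "g (vec.span {N1 *v u}) = vec.span {(N2 ** B) *v (N1 *v u)}"
        unfolding g_def by (simp add: linear_image_span_singleton)
      also have "(N2 ** B) *v (N1 *v u) = N2 *v ((B ** N1) *v u)"
        by (simp only: matrix_vector_mul_assoc matrix_mul_assoc)
      finally show ?thesis unfolding B(1) matrix_vector_mul_lid .
    qed
    then show ?thesis unfolding U1 U2 image_image by (rule image_cong[OF refl])
  qed
  ultimately show ?thesis by (intro bexI)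
qed

end
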